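(* \textsc{Colored Clustering} admits a kernel of size $\mathcal{O}(k^{5/2})$ with respect to the parameter $k$.
   Context: \textsc{Colored Clustering}: given a graph $G=(V,E)$, an edge coloring $\ell\colon E\to C$, and $k\in\mathbb{N}$, decide whether there is a stable $F\subseteq E$ with $|F|\ge k$; $F$ is stable if $\ell(e)=\ell(e')$ whenever $e,e'\in F$ share a vertex. A kernel is a polynomial-time algorithm mapping an instance $(x,k)$ to an equivalent instance $(x',k')$ whose size is bounded by a function of $k$ (here $\mathcal{O}(k^{5/2})$). *)

theory Defs
  imports Complex_Main "HOL-Library.Landau_Symbols" "HOL-Computational_Algebra.Polynomial"
begin

section \<open>Edge-coloured graphs and stable edge sets\<close>

definition simple_graph :: "'v set \<Rightarrow> 'v set set \<Rightarrow> bool" where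
  "simple_graph V E \<longleftrightarrow> finite V \<and> (\<forall>e\<in>E. e \<subseteq> V \<and> card e = 2)"

definition stable :: "('v set \<Rightarrow> 'c) \<Rightarrow> 'v set set \<Rightarrow> bool" where
  "stable l F \<longleftrightarrow> (\<forall>e\<in>F. \<forall>e'\<in>F. e \<inter> e' \<noteq> {} \<longrightarrow> l e = l e')"

definition colored_clustering :: "'v set set \<Rightarrow> ('v set \<Rightarrow> 'c) \<Rightarrow> nat \<Rightarrow> bool" where
  "colored_clustering E l k \<longleftrightarrow> (\<exists>F\<subseteq>E. stable l F \<and> card F \<ge> k)"


section \<open>Model of computation\<close>

text \<open>
  The WHILE language over binary trees of N. D. Jones (Computability and Complexity: From a
  Programming Perspective, MIT Press 1997).  Evaluating an expression is charged the size of
  every value produced on the way, so a tree may not be copied at unit cost; in particular the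
  memory used is bounded by the size of the input plus the time.  Hence running times
  are polynomially related to those of Turing machines in both directions.
\<close>

datatype data = Leaf | Node data data

fun dsize :: "data \<Rightarrow> nat" where
  "dsize Leaf = 1"
| "dsize (Node a b) = 1 + dsize a + dsize b"

datatype expr = Var nat | Nl | Cns expr expr | Hd expr | Tl expr | Eq expr expr

datatype cmd = Skip | Assign nat expr | Seq cmd cmd | If expr cmd cmd | While expr cmd

type_synonym store = "nat \<Rightarrow> data"

fun dhd :: "data \<Rightarrow> data" where
  "dhd Leaf = Leaf"
| "dhd (Node a b) = a"

fun dtl :: "data \<Rightarrow> data" where
  "dtl Leaf = Leaf"
| "dtl (Node a b) = b"

fun val :: "expr \<Rightarrow> store \<Rightarrow> data" where
  "val (Var x) s = s x"
| "val Nl s = Leaf"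
| "val (Cns a b) s = Node (val a s) (val b s)"
| "val (Hd a) s = dhd (val a s)"
| "val (Tl a) s = dtl (val a s)"
| "val (Eq a b) s = (if val a s = val b s then Node Leaf Leaf else Leaf)"

fun cost :: "expr \<Rightarrow> store \<Rightarrow> nat" where
  "cost (Var x) s = dsize (val (Var x) s)"
| "cost Nl s = dsize (val Nl s)"
| "cost (Cns a b) s = cost a s + cost b s + dsize (val (Cns a b) s)"
| "cost (Hd a) s = cost a s + dsize (val (Hd a) s)"
| "cost (Tl a) s = cost a s + dsize (val (Tl a) s)"
| "cost (Eq a b) s = cost a s + cost b s + dsize (val (Eq a b) s)"

text \<open>\<open>exec c s t s'\<close>: started in store \<open>s\<close>, the command \<open>c\<close> halts after \<open>t\<close> time units in
  store \<open>s'\<close>.  Only the tree \<open>Leaf\<close> counts as false.\<close>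

inductive exec :: "cmd \<Rightarrow> store \<Rightarrow> nat \<Rightarrow> store \<Rightarrow> bool" where
  Skip: "exec Skip s 1 s"
| Assign: "exec (Assign x e) s (1 + cost e s) (s(x := val e s))"
| Seq: "exec c1 s t1 s1 \<Longrightarrow> exec c2 s1 t2 s2 \<Longrightarrow> exec (Seq c1 c2) s (1 + t1 + t2) s2"
| IfTrue: "val e s \<noteq> Leaf \<Longrightarrow> exec c1 s t s1 \<Longrightarrow> exec (If e c1 c2) s (1 + cost e s + t) s1"
| IfFalse: "val e s = Leaf \<Longrightarrow> exec c2 s t s1 \<Longrightarrow> exec (If e c1 c2) s (1 + cost e s + t) s1"
| WhileFalse: "val e s = Leaf \<Longrightarrow> exec (While e c) s (1 + cost e s) s"
| WhileTrue: "val e s \<noteq> Leaf \<Longrightarrow> exec c s t1 s1 \<Longrightarrow> exec (While e c) s1 t2 s2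
    \<Longrightarrow> exec (While e c) s (1 + cost e s + t1 + t2) s2"

inductive_cases exec_SkipE: "exec Skip s t s'"
inductive_cases exec_AssignE: "exec (Assign x e) s t s'"

lemma exec_deterministic:
  "exec c s t s1 \<Longrightarrow> exec c s u s2 \<Longrightarrow> u = t \<and> s2 = s1"
proof (induction arbitrary: u s2 rule: exec.induct)
  case (Seq c1 s t1 s1 c2 t2 s3)
  from Seq.prems obtain v1 s' v2
    where "u = 1 + v1 + v2" "exec c1 s v1 s'" "exec c2 s' v2 s2"
    by cases auto
  then show ?case using Seq.IH(1)[of v1 s'] Seq.IH(2)[of v2 s2] by simp
next
  case (WhileTrue e s c t1 s1 t2 s3)
  from WhileTrue.prems obtain v1 s' v2
    where "u = 1 + cost e s + v1 + v2" "exec c s v1 s'" "exec (While e c) s' v2 s2"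
    by cases (use WhileTrue.hyps(1) in auto)
  then show ?case using WhileTrue.IH(1)[of v1 s'] WhileTrue.IH(2)[of v2 s2] by simp
next
  case (IfTrue e s c1 t s1 c2)
  from IfTrue.prems obtain v where "u = 1 + cost e s + v" "exec c1 s v s2"
    by cases (use IfTrue.hyps(1) in auto)
  then show ?case using IfTrue.IH[of v s2] by simp
next
  case (IfFalse e s c2 t s1 c1)
  from IfFalse.prems obtain v where "u = 1 + cost e s + v" "exec c2 s v s2"
    by cases (use IfFalse.hyps(1) in auto)
  then show ?case using IfFalse.IH[of v s2] by simp
next
  case (WhileFalse e s c)
  from WhileFalse.prems show ?case by cases (use WhileFalse.hyps in auto)
qed (auto elim: exec_SkipE exec_AssignE)

lemma dsize_val_le_cost: "dsize (val e s) \<le> cost e s"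
  by (cases e) auto

lemma exec_dsize_le: "exec c s t s' \<Longrightarrow> dsize (s' x) \<le> dsize (s x) + t"
proof (induction rule: exec.induct)
  case (Assign y e s)
  then show ?case using dsize_val_le_cost[of e s] by auto
qed auto

text \<open>Input and output are passed in variable 0; all other variables are initially \<open>Leaf\<close>.\<close>

definition computes_in :: "cmd \<Rightarrow> data \<Rightarrow> data \<Rightarrow> nat \<Rightarrow> bool" where
  "computes_in c x y t \<longleftrightarrow> (\<exists>s. exec c ((\<lambda>_. Leaf)(0 := x)) t s \<and> s 0 = y)"

definition polytime_on :: "'a set \<Rightarrow> ('a \<Rightarrow> data) \<Rightarrow> ('b \<Rightarrow> data) \<Rightarrow> ('a \<Rightarrow> 'b) \<Rightarrow> bool" where
  "polytime_on A encA encB f \<longleftrightarrow>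
    (\<exists>c (p :: nat poly). \<forall>a\<in>A. \<exists>t. computes_in c (encA a) (encB (f a)) t \<and>
       t \<le> poly p (dsize (encA a)))"


section \<open>Parameterized problems and kernels\<close>

record 'i param_problem =
  instances :: "'i set"
  yes_instances :: "'i set"
  parameter :: "'i \<Rightarrow> nat"
  encode :: "'i \<Rightarrow> data"
  instance_size :: "'i \<Rightarrow> nat"

definition kernelization :: "'i param_problem \<Rightarrow> ('i \<Rightarrow> 'i) \<Rightarrow> (nat \<Rightarrow> nat) \<Rightarrow> bool" where
  "kernelization P K f \<longleftrightarrow>
     polytime_on (instances P) (encode P) (encode P) K \<and>
     (\<forall>I\<in>instances P. K I \<in> instances P \<and>
        (K I \<in> yes_instances P \<longleftrightarrow> I \<in> yes_instances P) \<and>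
        instance_size P (K I) \<le> f (parameter P I))"

definition admits_kernel_of_size :: "'i param_problem \<Rightarrow> (nat \<Rightarrow> real) \<Rightarrow> bool" where
  "admits_kernel_of_size P g \<longleftrightarrow>
     (\<exists>K f. kernelization P K f \<and> (\<lambda>k. real (f k)) \<in> O(g))"


section \<open>Colored Clustering as a parameterized problem\<close>

text \<open>The vertex set is \<open>{..<nverts I}\<close> and the colour set is \<open>{..<ncolors I}\<close>; an entry
  \<open>(u, v, c)\<close> of \<open>edge_list I\<close> is the edge \<open>{u, v}\<close> of colour \<open>c\<close>.\<close>

record cc_instance =
  nverts :: nat
  ncolors :: nat
  edge_list :: "(nat \<times> nat \<times> nat) list"
  target :: nat

definition verts_of :: "cc_instance \<Rightarrow> nat set" where
  "verts_of I = {..<nverts I}"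

definition edges_of :: "cc_instance \<Rightarrow> nat set set" where
  "edges_of I = (\<lambda>(u, v, c). {u, v}) ` set (edge_list I)"

definition color_of :: "cc_instance \<Rightarrow> nat set \<Rightarrow> nat" where
  "color_of I e = (THE c. \<exists>u v. (u, v, c) \<in> set (edge_list I) \<and> e = {u, v})"

definition cc_wf :: "cc_instance \<Rightarrow> bool" where
  "cc_wf I \<longleftrightarrow>
     (\<forall>(u, v, c)\<in>set (edge_list I). u < nverts I \<and> v < nverts I \<and> u \<noteq> v \<and> c < ncolors I) \<and>
     distinct (map (\<lambda>(u, v, c). {u, v}) (edge_list I))"

text \<open>Numbers are written in unary.  Since vertices and colours are numbered consecutively, this
  makes the length of the encoding polynomially related to the number of vertices, edges and
  colours plus \<open>k\<close>, in line with the usual convention that an instance \<open>(x, k)\<close> of a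
  parameterized problem has size \<open>|x| + k\<close>.\<close>

fun enc_list :: "('a \<Rightarrow> data) \<Rightarrow> 'a list \<Rightarrow> data" where
  "enc_list f [] = Leaf"
| "enc_list f (x # xs) = Node (f x) (enc_list f xs)"

fun enc_nat :: "nat \<Rightarrow> data" where
  "enc_nat 0 = Leaf"
| "enc_nat (Suc n) = Node Leaf (enc_nat n)"

fun enc_edge :: "nat \<times> nat \<times> nat \<Rightarrow> data" where
  "enc_edge (u, v, c) = Node (enc_nat u) (Node (enc_nat v) (enc_nat c))"

definition enc_cc :: "cc_instance \<Rightarrow> data" where
  "enc_cc I = Node (enc_nat (nverts I)) (Node (enc_nat (ncolors I))
     (Node (enc_list enc_edge (edge_list I)) (enc_nat (target I))))"

definition cc_size :: "cc_instance \<Rightarrow> nat" where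
  "cc_size I = nverts I + length (edge_list I) + ncolors I + target I"

definition Colored_Clustering :: "cc_instance param_problem" where
  "Colored_Clustering = \<lparr>
     instances = {I. cc_wf I},
     yes_instances = {I. cc_wf I \<and> colored_clustering (edges_of I) (color_of I) (target I)},
     parameter = target,
     encode = enc_cc,
     instance_size = cc_size\<rparr>"

lemma enc_nat_inj: "enc_nat m = enc_nat n \<longleftrightarrow> m = n"
proof (induction m arbitrary: n)
  case 0
  then show ?case by (cases n) auto
next
  case (Suc m)
  then show ?case by (cases n) auto
qed

lemma enc_list_inj:
  assumes "inj f"
  shows "enc_list f xs = enc_list f ys \<longleftrightarrow> xs = ys"
proof (induction xs arbitrary: ys)
  case Nil
  then show ?case by (cases ys) auto
next
  case (Cons x xs)
  then show ?case using assms by (cases ys) (auto simp: inj_eq)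
qed

lemma enc_edge_inj: "inj enc_edge"
  by (auto simp: inj_def enc_nat_inj)

lemma enc_cc_inj: "inj enc_cc"
  by (auto simp: inj_def enc_cc_def enc_nat_inj enc_list_inj[OF enc_edge_inj])

lemma cc_wf_simple_graph: "cc_wf I \<Longrightarrow> simple_graph (verts_of I) (edges_of I)"
  by (auto simp: cc_wf_def simple_graph_def verts_of_def edges_of_def)

lemma cc_wf_card_edges: "cc_wf I \<Longrightarrow> card (edges_of I) = length (edge_list I)"
  unfolding edges_of_def cc_wf_def set_map[symmetric] by (simp add: distinct_card del: set_map)

lemma cc_wf_color_of:
  assumes "cc_wf I" and "(u, v, c) \<in> set (edge_list I)"
  shows "color_of I {u, v} = c"
proof -
  have inj: "inj_on (\<lambda>(u, v, c). {u, v}) (set (edge_list I))"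
    using assms(1) by (simp add: cc_wf_def distinct_map)
  have uniq: "c' = c" if "(u', v', c') \<in> set (edge_list I)" "{u, v} = {u', v'}" for u' v' c'
    using inj_onD[OF inj _ that(1) assms(2)] that(2) by simp
  show ?thesis
    unfolding color_of_def
  proof (rule the_equality)
    show "\<exists>u' v'. (u', v', c) \<in> set (edge_list I) \<and> {u, v} = {u', v'}"
      using assms(2) by blast
  next
    fix c' assume "\<exists>u' v'. (u', v', c') \<in> set (edge_list I) \<and> {u, v} = {u', v'}"
    then show "c' = c" by (elim exE conjE) (rule uniq)
  qed
qed

lemma cc_wf_color_range: "cc_wf I \<Longrightarrow> e \<in> edges_of I \<Longrightarrow> color_of I e < ncolors I"
proof -
  assume wf: "cc_wf I" and "e \<in> edges_of I"
  then obtain u v c where *: "(u, v, c) \<in> set (edge_list I)" "e = {u, v}"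
    by (auto simp: edges_of_def)
  then have "c < ncolors I" using wf by (auto simp: cc_wf_def)
  then show ?thesis using cc_wf_color_of[OF wf *(1)] *(2) by simp
qed

end

theory Submission imports Defs begin

text \<open>
  If at a vertex \<open>v\<close> more than \<open>2 k\<close> other colours are at least as frequent as \<open>c\<close>, the
  \<open>c\<close>-edges at \<open>v\<close> may be deleted, since a solution using them can switch to the untouched star
  of a rival colour.  Afterwards every vertex sees at most \<open>q = 2 k + 1\<close> colours.  Let \<open>r\<close> be the
  square root of \<open>k\<close>, rounded up.  In a no-instance a maximal matching yields a vertex cover of size
  at most \<open>2 k\<close>, every degree is at most \<open>q k\<close>, and at most \<open>r\<close> vertices have degree at least
  \<open>T = r + 2 r\<^sup>2 + q r\<close>, because \<open>r\<close> of them would greedily yield \<open>r\<close> disjoint monochromatic stars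
  with \<open>r\<close> edges each.  Hence there are at most \<open>2 k T + r q k\<close> edges, which is of order
  \<open>k powr (5/2)\<close>; if there are more, the answer is yes.  Otherwise the used vertices and colours are
  renumbered consecutively.
\<close>

section \<open>Stable edge sets\<close>

text \<open>The exponent 5/2 comes from a balance. Stars of \<open>r\<close> edges at
  \<open>r\<close> centres give \<open>k\<close> edges once \<open>r * r \<ge> k\<close>, so
  \<open>r\<close> is about the square root of \<open>k\<close>. Then \<open>T\<close> is dominated
  by \<open>q * r\<close>, of order \<open>k * r\<close>, and the at most \<open>2 * k\<close> light
  cover vertices, of degree below \<open>T\<close>, and the at most \<open>r\<close> heavy ones, of
  degree up to \<open>q * k\<close>, both account for order \<open>k * k * r\<close> edges. The
  deletion rule is tried once per vertex and colour, without iterating to a fixpoint: deletions at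
  \<open>v\<close> take a colour entirely or not at all, so a surviving colour never gains rivals
  there, and deletions at other vertices cannot enlarge the palette of \<open>v\<close>. Polynomial
  time refers to WHILE programs, so the algorithm is assembled from maps, filters and folds over
  lists, for which closure rules are proved. The obstacle is the fold, whose accumulator must be
  shown to stay polynomially small.\<close>

definition edges_at :: "'v set set \<Rightarrow> 'v \<Rightarrow> 'v set set" where
  "edges_at E v = {e \<in> E. v \<in> e}"

definition coloured_edges_at :: "('v set \<Rightarrow> 'c) \<Rightarrow> 'v set set \<Rightarrow> 'v \<Rightarrow> 'c \<Rightarrow> 'v set set" where
  "coloured_edges_at l E v c = {e \<in> E. v \<in> e \<and> l e = c}"

lemma simple_graph_finite: "simple_graph V E \<Longrightarrow> finite E"
  unfolding simple_graph_def by (meson PowI finite_Pow_iff finite_subset subsetI)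

lemma simple_graph_card_Union:
  assumes "simple_graph V E" "F \<subseteq> E"
  shows "card (\<Union>F) \<le> 2 * card F"
proof -
  have "card (\<Union>F) \<le> (\<Sum>e\<in>F. card e)" by (rule card_Union_le_sum_card)
  also have "\<dots> = (\<Sum>e\<in>F. 2)"
    using assms unfolding simple_graph_def by (intro sum.cong) auto
  finally show ?thesis by simp
qed

lemma simple_graph_finite_Union:
  assumes "simple_graph V E" "F \<subseteq> E"
  shows "finite (\<Union>F)"
  using assms unfolding simple_graph_def by (meson Sup_least finite_subset subset_iff)

lemma simple_graph_edge_other_end:
  assumes "simple_graph V E" "e \<in> E" "v \<in> e"
  obtains w where "w \<noteq> v" "e = {v, w}"
proof -
  have "card e = 2" using assms unfolding simple_graph_def by blast
  then obtain x y where "e = {x, y}" "x \<noteq> y" by (auto simp: card_2_iff)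
  then show ?thesis using assms(3) that[of x] that[of y] by (auto simp: insert_commute)
qed

lemma colored_clusteringE:
  assumes "colored_clustering E l k"
  obtains F where "F \<subseteq> E" "stable l F" "card F = k" "finite F"
proof -
  obtain F where F: "F \<subseteq> E" "stable l F" "k \<le> card F"
    using assms unfolding colored_clustering_def by blast
  obtain G where G: "G \<subseteq> F" "card G = k" "finite G"
    using obtain_subset_with_card_n[OF F(3)] by metis
  show ?thesis by (rule that[of G]) (use F G in \<open>auto simp: stable_def\<close>)
qed

lemma colored_clustering_mono:
  "colored_clustering E' l k \<Longrightarrow> E' \<subseteq> E \<Longrightarrow> colored_clustering E l k"
  unfolding colored_clustering_def by blast

text \<open>In a simple graph an edge at \<open>v\<close> is fixed by its other end, which here lies
  in \<open>Z\<close>. With \<open>Z\<close> the vertices already touched, this counts the blocked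
  edges at \<open>v\<close>.\<close>

lemma card_edges_at_meeting:
  assumes "simple_graph V E" "finite Z"
  shows "card {e \<in> E. v \<in> e \<and> (e - {v}) \<inter> Z \<noteq> {}} \<le> card Z"
proof (rule surj_card_le)
  show "{e \<in> E. v \<in> e \<and> (e - {v}) \<inter> Z \<noteq> {}} \<subseteq> (\<lambda>z. {v, z}) ` Z"
    by (auto elim!: simple_graph_edge_other_end[OF assms(1)])
qed (rule assms)

text \<open>A solution using colour \<open>c\<close> at \<open>v\<close> touches at most \<open>2 k\<close> vertices, so among more than \<open>2 k\<close>
  rival colours one has its star at \<open>v\<close> free; swapping the stars does not decrease the solution.\<close>

lemma colored_clustering_remove_colour:
  fixes D :: "'c set"
  assumes E: "simple_graph V E"
    and D: "finite D" "2 * k < card D" "c \<notin> D"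
      "\<And>d. d \<in> D \<Longrightarrow> card (coloured_edges_at l E v c) \<le> card (coloured_edges_at l E v d)"
    and sol: "colored_clustering E l k"
  shows "colored_clustering (E - coloured_edges_at l E v c) l k"
proof -
  obtain F where F: "F \<subseteq> E" "stable l F" "card F = k" "finite F"
    using colored_clusteringE[OF sol] by blast
  have finE: "finite E" using simple_graph_finite[OF E] .
  show ?thesis
  proof (cases "F \<inter> coloured_edges_at l E v c = {}")
    case True
    then have "F \<subseteq> E - coloured_edges_at l E v c" using F by blast
    then show ?thesis using F unfolding colored_clustering_def by blast
  next
    case False
    then obtain e0 where e0: "e0 \<in> F" "v \<in> e0" "l e0 = c" unfolding coloured_edges_at_def by blast
    define F0 where "F0 = {e \<in> F. v \<notin> e}"
    have F0: "F0 \<subseteq> F" "F0 \<subseteq> E" "finite F0" using F unfolding F0_def by auto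
    \<comment> \<open>Edges of \<open>F\<close> at \<open>v\<close> share \<open>v\<close> with
      \<open>e0\<close>, so stability gives them all the colour \<open>c\<close>.\<close>
    have "F - F0 \<subseteq> coloured_edges_at l E v c"
      using F(1,2) e0 unfolding F0_def coloured_edges_at_def stable_def by blast
    then have "card (F - F0) \<le> card (coloured_edges_at l E v c)"
      using finE by (intro card_mono) (auto simp: coloured_edges_at_def)
    then have cF0: "k \<le> card F0 + card (coloured_edges_at l E v c)"
      using F(3,4) F0 card_Diff_subset[of F0 F] by simp
    define Z where "Z = \<Union>F0"
    have Z: "finite Z" "card Z \<le> 2 * k" "v \<notin> Z"
      using simple_graph_finite_Union[OF E F0(2)] simple_graph_card_Union[OF E F0(2)]
        card_mono[OF F(4) F0(1)] F(3) unfolding Z_def F0_def by auto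
    have "\<exists>d\<in>D. \<forall>e\<in>coloured_edges_at l E v d. e \<inter> Z = {}"
    proof (rule ccontr)
      assume "\<not> ?thesis"
      then have "\<forall>d\<in>D. \<exists>e. e \<in> coloured_edges_at l E v d \<and> e \<inter> Z \<noteq> {}" by blast
      \<comment> \<open>One blocked edge per rival: their colours differ, so they are distinct edges
        at \<open>v\<close> meeting \<open>Z\<close>, of which there are at most
        \<open>2 * k\<close>.\<close>
      then obtain g where g: "\<And>d. d \<in> D \<Longrightarrow> g d \<in> coloured_edges_at l E v d \<and> g d \<inter> Z \<noteq> {}"
        by metis
      have lg: "l (g d) = d" if "d \<in> D" for d using g[OF that] unfolding coloured_edges_at_def by simp
      have "inj_on g D" using lg by (metis inj_onI)
      moreover have "g ` D \<subseteq> {e \<in> E. v \<in> e \<and> (e - {v}) \<inter> Z \<noteq> {}}"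
        using g Z(3) unfolding coloured_edges_at_def by blast
      ultimately have "card D \<le> card {e \<in> E. v \<in> e \<and> (e - {v}) \<inter> Z \<noteq> {}}"
        using finE by (intro card_inj_on_le[of g]) auto
      then show False using card_edges_at_meeting[OF E Z(1), of v] Z(2) D(2) by simp
    qed
    then obtain d where d: "d \<in> D" "\<And>e. e \<in> coloured_edges_at l E v d \<Longrightarrow> e \<inter> Z = {}" by blast
    let ?S = "coloured_edges_at l E v d"
    have S: "?S \<subseteq> E" "finite ?S" "F0 \<inter> ?S = {}"
      using finE unfolding coloured_edges_at_def F0_def by auto
    have "stable l (F0 \<union> ?S)"
      using F(2) F0(1) d(2) unfolding stable_def Z_def coloured_edges_at_def
      by (smt (verit, best) Int_commute UnE UnionI disjoint_iff mem_Collect_eq subsetD)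
    moreover have "F0 \<union> ?S \<subseteq> E - coloured_edges_at l E v c"
      using F0(2) S(1) d(1) D(3) unfolding F0_def coloured_edges_at_def by auto
    moreover have "k \<le> card (F0 \<union> ?S)"
      using cF0 D(4)[OF d(1)] S F0 by (simp add: card_Un_disjoint)
    ultimately show ?thesis unfolding colored_clustering_def by blast
  qed
qed

section \<open>Counting edges when every vertex sees few colours\<close>

lemma card_edges_at_colours:
  assumes "finite E"
  shows "card (edges_at E v) = (\<Sum>c\<in>l ` edges_at E v. card (coloured_edges_at l E v c))"
proof -
  have "card (edges_at E v) = (\<Sum>e\<in>edges_at E v. 1)" by simp
  also have "\<dots> = (\<Sum>c\<in>l ` edges_at E v. \<Sum>e\<in>{e \<in> edges_at E v. l e = c}. 1)"
    using assms by (intro sum.image_gen) (auto simp: edges_at_def)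
  also have "\<dots> = (\<Sum>c\<in>l ` edges_at E v. card (coloured_edges_at l E v c))"
    by (intro sum.cong) (auto simp: edges_at_def coloured_edges_at_def intro!: arg_cong[of _ _ card])
  finally show ?thesis .
qed

text \<open>The clause \<open>\<Union>F \<inter> W \<subseteq> U\<close> keeps the centres still
  waiting untouched. In the degree threshold, \<open>r\<close> pays for the other centres,
  \<open>2 * (r * r)\<close> for the ends of the edges chosen so far, and \<open>q * r\<close>
  leaves enough free edges for one of at most \<open>q\<close> colours to occur \<open>r\<close>
  times.\<close>

lemma greedy_stars:
  assumes E: "simple_graph V E" and r: "0 < r"
    and q: "\<And>v. card (l ` edges_at E v) \<le> q"
    and W: "finite W" "card W \<le> r" "\<And>v. v \<in> W \<Longrightarrow> r + 2 * (r * r) + q * r \<le> card (edges_at E v)"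
    and U: "finite U" "U \<subseteq> W"
  shows "\<exists>F\<subseteq>E. stable l F \<and> card F = card U * r \<and> \<Union>F \<inter> W \<subseteq> U"
  using U
proof (induction U rule: finite_induct)
  case empty
  show ?case by (rule exI[of _ "{}"]) (simp add: stable_def)
next
  case (insert v U)
  have finE: "finite E" using simple_graph_finite[OF E] .
  obtain F where F: "F \<subseteq> E" "stable l F" "card F = card U * r" "\<Union>F \<inter> W \<subseteq> U"
    using insert by auto
  have v: "v \<in> W" "v \<notin> \<Union>F" using insert F by auto
  \<comment> \<open>The other centres are blocked too, so that the new star preserves the invariant
    on \<open>W\<close>.\<close>
  define Z where "Z = \<Union>F \<union> (W - {v})"
  have "card U < r"
  proof -
    have "card (insert v U) \<le> card W" using insert W by (intro card_mono) auto
    then show ?thesis using insert W by simp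
  qed
  then have "card U * r \<le> r * r" by (intro mult_right_mono) auto
  moreover have "card Z \<le> card (\<Union>F) + card (W - {v})" unfolding Z_def by (rule card_Un_le)
  moreover have "card (W - {v}) \<le> r"
    using W card_mono[of W "W - {v}"] by auto
  ultimately have cZ: "card Z \<le> r + 2 * (r * r)"
    using simple_graph_card_Union[OF E F(1)] F(3) by linarith
  have Z: "finite Z" "v \<notin> Z"
    using simple_graph_finite_Union[OF E F(1)] W v unfolding Z_def by auto
  define E' where "E' = {e \<in> E. e \<inter> Z = {}}"
  have "edges_at E v \<subseteq> edges_at E' v \<union> {e \<in> E. v \<in> e \<and> (e - {v}) \<inter> Z \<noteq> {}}"
    using Z(2) unfolding edges_at_def E'_def by blast
  then have "card (edges_at E v) \<le> card (edges_at E' v \<union> {e \<in> E. v \<in> e \<and> (e - {v}) \<inter> Z \<noteq> {}})"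
    using finE by (intro card_mono) (auto simp: edges_at_def E'_def)
  also have "\<dots> \<le> card (edges_at E' v) + card {e \<in> E. v \<in> e \<and> (e - {v}) \<inter> Z \<noteq> {}}"
    by (rule card_Un_le)
  finally have free: "q * r \<le> card (edges_at E' v)"
    using card_edges_at_meeting[OF E Z(1), of v] cZ W(3)[OF v(1)] by simp
  have finE': "finite E'" using finE unfolding E'_def by simp
  have "card (l ` edges_at E' v) \<le> card (l ` edges_at E v)"
    using finE by (intro card_mono image_mono) (auto simp: edges_at_def E'_def)
  then have q': "card (l ` edges_at E' v) \<le> q" using q[of v] by simp
  \<comment> \<open>The strict step \<open>q * (r - 1) < q * r\<close> below requires
    \<open>q\<close> positive; the colour of any edge at \<open>v\<close> shows this.\<close>
  have ne: "edges_at E v \<noteq> {}" using W(3)[OF v(1)] r by auto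
  then have "0 < card (l ` edges_at E v)" using finE by (simp add: card_gt_0_iff edges_at_def)
  then have "0 < q" using q[of v] by simp
  have "\<exists>c. r \<le> card (coloured_edges_at l E' v c)"
  proof (rule ccontr)
    assume "\<not> ?thesis"
    then have "card (coloured_edges_at l E' v c) < r" for c by (meson not_le)
    then have "card (coloured_edges_at l E' v c) \<le> r - 1" for c
      using r by (simp add: less_eq_Suc_le le_diff_conv2)
    then have "card (edges_at E' v) \<le> card (l ` edges_at E' v) * (r - 1)"
      unfolding card_edges_at_colours[OF finE', of v l] by (intro sum_bounded_above[THEN order_trans]) auto
    also have "\<dots> \<le> q * (r - 1)" using q' by simp
    also have "\<dots> < q * r" using \<open>0 < q\<close> r by simp
    finally show False using free by simp
  qed
  then obtain c where "r \<le> card (coloured_edges_at l E' v c)" by blast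
  \<comment> \<open>Exactly \<open>r\<close> edges are kept, because the size of \<open>F\<close>
    bounds the vertices blocked for later centres.\<close>
  then obtain S where S: "S \<subseteq> coloured_edges_at l E' v c" "card S = r" "finite S"
    using obtain_subset_with_card_n by metis
  have S': "e \<in> E" "v \<in> e" "l e = c" "e \<inter> Z = {}" if "e \<in> S" for e
    using S(1) that unfolding coloured_edges_at_def E'_def by auto
  have FS: "e \<inter> e' = {}" if "e \<in> F" "e' \<in> S" for e e'
    using S'(4)[OF that(2)] that(1) unfolding Z_def by blast
  have "stable l (F \<union> S)"
    using F(2) FS S'(3) unfolding stable_def by (metis Int_commute UnE)
  moreover have "card (F \<union> S) = card F + card S"
    using finite_subset[OF F(1) finE] S(3) S'(2) v(2) by (intro card_Un_disjoint) auto
  moreover have "\<Union>(F \<union> S) \<inter> W \<subseteq> insert v U"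
    using F(4) S'(4) unfolding Z_def by blast
  ultimately show ?case
    using F(1) S'(1) F(3) S(2) insert.hyps by (intro exI[of _ "F \<union> S"]) auto
qed

text \<open>A matching is stable under every colouring, so in a no-instance it has fewer than
  \<open>k\<close> edges; the ends of a largest one meet every edge.\<close>

lemma matching_vertex_cover:
  assumes E: "simple_graph V E" and no: "\<not> colored_clustering E l k"
  obtains X where "finite X" "card X \<le> 2 * k" "\<And>e. e \<in> E \<Longrightarrow> e \<inter> X \<noteq> {}"
proof -
  define P where "P F \<longleftrightarrow> F \<subseteq> E \<and> (\<forall>e\<in>F. \<forall>e'\<in>F. e \<inter> e' \<noteq> {} \<longrightarrow> e = e')" for F
  have finE: "finite E" using simple_graph_finite[OF E] .
  have "P {}" unfolding P_def by simp
  moreover have "\<forall>F. P F \<longrightarrow> card F < Suc (card E)"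
    using card_mono[OF finE] unfolding P_def by (simp add: less_Suc_eq_le)
  ultimately obtain F where F: "P F" "\<And>G. P G \<Longrightarrow> card G \<le> card F"
    using ex_has_greatest_nat[of P "{}" card "Suc (card E)"] by blast
  have FE: "F \<subseteq> E" and finF: "finite F" using F(1) finite_subset[OF _ finE] unfolding P_def by auto
  have "stable l F" using F(1) unfolding P_def stable_def by blast
  then have "card F < k" using no FE unfolding colored_clustering_def by (meson not_le)
  moreover have "e \<inter> \<Union>F \<noteq> {}" if "e \<in> E" for e
  proof
    assume *: "e \<inter> \<Union>F = {}"
    have "e \<noteq> {}" using E that unfolding simple_graph_def by auto
    then have "e \<notin> F" using * by blast
    moreover have "P (insert e F)" using F(1) * that unfolding P_def by blast
    ultimately show False using F(2)[of "insert e F"] finF by simp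
  qed
  ultimately show ?thesis
    using that[of "\<Union>F"] simple_graph_finite_Union[OF E FE] simple_graph_card_Union[OF E FE] by simp
qed

lemma colored_clustering_if_many_edges:
  assumes E: "simple_graph V E"
    and q: "\<And>v. card (l ` edges_at E v) \<le> q"
    and r: "k \<le> r * r"
    and many: "2 * k * (r + 2 * (r * r) + q * r) + r * (q * k) < card E"
  shows "colored_clustering E l k"
proof (rule ccontr)
  assume no: "\<not> colored_clustering E l k"
  have finE: "finite E" using simple_graph_finite[OF E] .
  \<comment> \<open>The empty set settles \<open>k = 0\<close>; hence \<open>r\<close> is positive,
    as \<open>greedy_stars\<close> requires.\<close>
  have "0 < k" using no by (cases k) (auto simp: colored_clustering_def stable_def intro: exI[of _ "{}"])
  then have r0: "0 < r" using r by (cases r) auto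
  let ?T = "r + 2 * (r * r) + q * r"
  have deg: "card (edges_at E v) \<le> q * k" for v
  proof -
    \<comment> \<open>Equally coloured edges are stable, so in a no-instance \<open>k\<close> bounds
      their number.\<close>
    have "card (coloured_edges_at l E v c) \<le> k" for c
    proof -
      have "coloured_edges_at l E v c \<subseteq> E" "stable l (coloured_edges_at l E v c)"
        unfolding coloured_edges_at_def stable_def by auto
      then show ?thesis using no unfolding colored_clustering_def by (meson linear)
    qed
    then have "card (edges_at E v) \<le> card (l ` edges_at E v) * k"
      unfolding card_edges_at_colours[OF finE, of v l]
      by (intro sum_bounded_above[THEN order_trans]) auto
    also have "\<dots> \<le> q * k" using q[of v] by simp
    finally show ?thesis .
  qed
  obtain X where X: "finite X" "card X \<le> 2 * k" "\<And>e. e \<in> E \<Longrightarrow> e \<inter> X \<noteq> {}"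
    using matching_vertex_cover[OF E no] by blast
  define H where "H = {x \<in> X. ?T \<le> card (edges_at E x)}"
  have H: "finite H" "H \<subseteq> X" using X unfolding H_def by auto
  have cH: "card H \<le> r"
  proof (rule ccontr)
    assume "\<not> card H \<le> r"
    then obtain W where W: "W \<subseteq> H" "card W = r" "finite W"
      using obtain_subset_with_card_n[of r H] by (metis linear)
    have "\<exists>F\<subseteq>E. stable l F \<and> card F = card W * r \<and> \<Union>F \<inter> W \<subseteq> W"
      by (rule greedy_stars[OF E r0 q]) (use W in \<open>auto simp: H_def\<close>)
    then show False using no r W unfolding colored_clustering_def by auto
  qed
  \<comment> \<open>Each edge is charged to a cover vertex: a light one stands for at most
    \<open>?T\<close> edges, a heavy one for at most \<open>q * k\<close>.\<close>
  have "E \<subseteq> (\<Union>x\<in>X. edges_at E x)" using X(3) unfolding edges_at_def by blast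
  then have "card E \<le> card (\<Union>x\<in>X. edges_at E x)"
    using X(1) finE by (intro card_mono) (auto simp: edges_at_def)
  also have "\<dots> \<le> (\<Sum>x\<in>X. card (edges_at E x))" by (rule card_UN_le[OF X(1)])
  also have "\<dots> = (\<Sum>x\<in>X - H. card (edges_at E x)) + (\<Sum>x\<in>H. card (edges_at E x))"
    using sum.subset_diff[OF H(2) X(1)] .
  also have "\<dots> \<le> (\<Sum>x\<in>X - H. ?T) + (\<Sum>x\<in>H. q * k)"
    using deg by (intro add_mono sum_mono) (auto simp: H_def)
  also have "\<dots> = card (X - H) * ?T + card H * (q * k)" by simp
  also have "\<dots> \<le> 2 * k * ?T + r * (q * k)"
    using card_mono[OF X(1), of "X - H"] X(2) cH by (intro add_mono mult_right_mono) auto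
  finally show False using many by simp
qed

text \<open>Stability depends only on which edges meet and which colours agree. Injectivity is asked
  only on the vertices and colours that occur, which is what \<open>rank\<close> offers.\<close>

lemma colored_clustering_image:
  assumes f: "inj_on f (\<Union>E)" and g: "inj_on g (l ` E)"
    and l': "\<And>e. e \<in> E \<Longrightarrow> l' (f ` e) = g (l e)"
  shows "colored_clustering ((`) f ` E) l' k \<longleftrightarrow> colored_clustering E l k"
proof -
  have inj: "inj_on ((`) f) E" using inj_on_image[OF f] .
  have st: "stable l' ((`) f ` F) \<longleftrightarrow> stable l F" if "F \<subseteq> E" for F
  proof -
    have "f ` e \<inter> f ` e' \<noteq> {} \<longleftrightarrow> e \<inter> e' \<noteq> {}" "l' (f ` e) = l' (f ` e') \<longleftrightarrow> l e = l e'"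
      if "e \<in> F" "e' \<in> F" for e e'
    proof -
      have "e \<in> E" "e' \<in> E" using that \<open>F \<subseteq> E\<close> by auto
      then show "l' (f ` e) = l' (f ` e') \<longleftrightarrow> l e = l e'" using l' g by (auto dest: inj_onD)
      have "f ` e \<inter> f ` e' = f ` (e \<inter> e')"
        using inj_on_image_Int[OF f, of e e'] \<open>e \<in> E\<close> \<open>e' \<in> E\<close> by auto
      then show "f ` e \<inter> f ` e' \<noteq> {} \<longleftrightarrow> e \<inter> e' \<noteq> {}" by simp
    qed
    then show ?thesis unfolding stable_def by (simp add: ball_simps)
  qed
  have cd: "card ((`) f ` F) = card F" if "F \<subseteq> E" for F
    using card_image[OF inj_on_subset[OF inj that]] .
  show ?thesis
  proof
    assume "colored_clustering ((`) f ` E) l' k"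
    then obtain G where "G \<subseteq> (`) f ` E" "stable l' G" "k \<le> card G"
      unfolding colored_clustering_def by blast
    then obtain F where "F \<subseteq> E" "G = (`) f ` F" by (auto simp: subset_image_iff)
    then show "colored_clustering E l k"
      using st cd \<open>stable l' G\<close> \<open>k \<le> card G\<close> unfolding colored_clustering_def by auto
  next
    assume "colored_clustering E l k"
    then obtain F where "F \<subseteq> E" "stable l F" "k \<le> card F"
      unfolding colored_clustering_def by blast
    then show "colored_clustering ((`) f ` E) l' k"
      using st cd unfolding colored_clustering_def by (intro exI[of _ "(`) f ` F"]) auto
  qed
qed

section \<open>Polynomial-time combinators for WHILE programs\<close>

text \<open>An upper bound on the time, unlike the exact time in \<open>exec\<close>, may be
  weakened at any stage.\<close>

definition runs :: "cmd \<Rightarrow> store \<Rightarrow> store \<Rightarrow> nat \<Rightarrow> bool" where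
  "runs c s s' T \<longleftrightarrow> (\<exists>t\<le>T. exec c s t s')"

lemma runs_mono: "runs c s s' T \<Longrightarrow> T \<le> U \<Longrightarrow> runs c s s' U"
  unfolding runs_def using le_trans by blast

lemma runs_eq: "runs c s s' T \<Longrightarrow> s' = s'' \<Longrightarrow> T \<le> U \<Longrightarrow> runs c s s'' U"
  using runs_mono by blast

lemma runs_Assign: "1 + cost e s \<le> T \<Longrightarrow> runs (Assign x e) s (s(x := val e s)) T"
  unfolding runs_def using exec.Assign by blast

lemma runs_Seq:
  assumes "runs c1 s s1 T1" "runs c2 s1 s2 T2"
  shows "runs (Seq c1 c2) s s2 (1 + T1 + T2)"
proof -
  obtain t1 t2 where t: "t1 \<le> T1" "t2 \<le> T2" "exec c1 s t1 s1" "exec c2 s1 t2 s2"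
    using assms unfolding runs_def by auto
  show ?thesis
    unfolding runs_def by (rule exI[of _ "1 + t1 + t2"]) (use t exec.Seq in auto)
qed

lemma runs_If:
  assumes "val e s \<noteq> Leaf \<Longrightarrow> runs c1 s s' T" "val e s = Leaf \<Longrightarrow> runs c2 s s' T"
  shows "runs (If e c1 c2) s s' (1 + cost e s + T)"
proof (cases "val e s = Leaf")
  case True
  then obtain t where "t \<le> T" "exec c2 s t s'" using assms unfolding runs_def by auto
  then show ?thesis unfolding runs_def
    by (intro exI[of _ "1 + cost e s + t"]) (use True exec.IfFalse in auto)
next
  case False
  then obtain t where "t \<le> T" "exec c1 s t s'" using assms unfolding runs_def by auto
  then show ?thesis unfolding runs_def
    by (intro exI[of _ "1 + cost e s + t"]) (use False exec.IfTrue in auto)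
qed

lemma runs_While_done: "val e s = Leaf \<Longrightarrow> runs (While e c) s s (1 + cost e s)"
  unfolding runs_def using exec.WhileFalse by blast

lemma runs_While_step:
  assumes "val e s \<noteq> Leaf" "runs c s s1 T1" "runs (While e c) s1 s2 T2"
  shows "runs (While e c) s s2 (1 + cost e s + T1 + T2)"
proof -
  obtain t1 t2 where t: "t1 \<le> T1" "t2 \<le> T2" "exec c s t1 s1" "exec (While e c) s1 t2 s2"
    using assms unfolding runs_def by auto
  show ?thesis unfolding runs_def
    by (rule exI[of _ "1 + cost e s + t1 + t2"]) (use t assms(1) exec.WhileTrue in auto)
qed

text \<open>Natural coefficients make every term monotone, so size bounds can be substituted into
  time bounds.\<close>

lemma poly_nat_mono: "x \<le> y \<Longrightarrow> poly p x \<le> poly (p :: nat poly) y"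
  by (induction p) (simp_all add: mult_le_mono)

text \<open>A program computing \<open>f\<close> uses the variables below \<open>m\<close> and clears all of them but variable 0,
  so that it can be run as a subroutine by any program that keeps its own data in higher
  variables.\<close>

definition computes :: "cmd \<Rightarrow> nat \<Rightarrow> nat poly \<Rightarrow> ('a \<Rightarrow> data) \<Rightarrow> ('b \<Rightarrow> data) \<Rightarrow> ('a \<Rightarrow> 'b) \<Rightarrow> bool" where
  "computes c m p eA eB f \<longleftrightarrow> (\<forall>s a. s 0 = eA a \<longrightarrow> (\<forall>i. 0 < i \<and> i < m \<longrightarrow> s i = Leaf) \<longrightarrow>
     runs c s (s(0 := eB (f a))) (poly p (dsize (eA a))))"

text \<open>All values of the input type are covered, not only well-formed instances, so composition
  has no side condition on ranges.\<close>

definition ptime :: "('a \<Rightarrow> data) \<Rightarrow> ('b \<Rightarrow> data) \<Rightarrow> ('a \<Rightarrow> 'b) \<Rightarrow> bool" where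
  "ptime eA eB f \<longleftrightarrow> (\<exists>c m p. computes c m p eA eB f)"

lemma computesD:
  assumes "computes c m p eA eB f" "s 0 = eA a" "\<And>i. 0 < i \<Longrightarrow> i < m \<Longrightarrow> s i = Leaf"
  shows "runs c s (s(0 := eB (f a))) (poly p (dsize (eA a)))"
  using assms unfolding computes_def by simp

lemma ptimeI:
  assumes "\<And>s a. s 0 = eA a \<Longrightarrow> (\<And>i. 0 < i \<Longrightarrow> i < m \<Longrightarrow> s i = Leaf) \<Longrightarrow>
     runs c s (s(0 := eB (f a))) (poly p (dsize (eA a)))"
  shows "ptime eA eB f"
  unfolding ptime_def computes_def
  by (intro exI[of _ c] exI[of _ m] exI[of _ p] allI impI) (simp add: assms)

lemma ptime_polytime_on:
  assumes "ptime eA eB f"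
  shows "polytime_on S eA eB f"
proof -
  obtain c m p where c: "computes c m p eA eB f"
    using assms unfolding ptime_def by blast
  have "\<exists>t. computes_in c (eA a) (eB (f a)) t \<and> t \<le> poly p (dsize (eA a))" for a
  proof -
    have "runs c ((\<lambda>_. Leaf)(0 := eA a)) (((\<lambda>_. Leaf)(0 := eA a))(0 := eB (f a)))
        (poly p (dsize (eA a)))"
      by (rule computesD[OF c]) auto
    then show ?thesis unfolding runs_def computes_in_def by fastforce
  qed
  then show ?thesis unfolding polytime_on_def by blast
qed

text \<open>A variable grows by at most the elapsed time (\<open>exec_dsize_le\<close>). This bounds
  intermediate results, on whose size the time of the next program depends.\<close>

lemma ptime_output_size:
  assumes "ptime eA eB f"
  obtains q :: "nat poly" where "\<And>a. dsize (eB (f a)) \<le> poly q (dsize (eA a))"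
proof -
  obtain c m p where c: "computes c m p eA eB f"
    using assms unfolding ptime_def by blast
  have "dsize (eB (f a)) \<le> poly ([:0, 1:] + p) (dsize (eA a))" for a
  proof -
    let ?s = "(\<lambda>_. Leaf)(0 := eA a)"
    have "runs c ?s (?s(0 := eB (f a))) (poly p (dsize (eA a)))"
      by (rule computesD[OF c]) auto
    then obtain t where "t \<le> poly p (dsize (eA a))" "exec c ?s t (?s(0 := eB (f a)))"
      unfolding runs_def by blast
    then show ?thesis using exec_dsize_le[of c ?s t "?s(0 := eB (f a))" 0] by simp
  qed
  then show ?thesis by (rule that)
qed

section \<open>Closure of polynomial time under composition, pairing and branching\<close>

lemma ptime_expr:
  assumes "\<And>s a. s 0 = eA a \<Longrightarrow> val e s = eB (f a)"
    and "\<And>s a. s 0 = eA a \<Longrightarrow> cost e s \<le> poly p (dsize (eA a))"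
  shows "ptime eA eB f"
proof (rule ptimeI[where m = 0 and c = "Assign 0 e" and p = "1 + p"])
  fix s :: store and a assume s: "s 0 = eA a"
  show "runs (Assign 0 e) s (s(0 := eB (f a))) (poly (1 + p) (dsize (eA a)))"
    using runs_Assign[of e s "poly (1 + p) (dsize (eA a))" 0] assms(1)[of s a, OF s]
      assms(2)[of s a, OF s] by simp
qed

lemma ptime_comp:
  assumes f: "ptime eA eB f" and g: "ptime eB eC g"
  shows "ptime eA eC (\<lambda>x. g (f x))"
proof -
  obtain c m p where c: "computes c m p eA eB f"
    using f unfolding ptime_def by blast
  obtain d n r where d: "computes d n r eB eC g"
    using g unfolding ptime_def by blast
  obtain q where q: "\<And>a. dsize (eB (f a)) \<le> poly q (dsize (eA a))"
    using ptime_output_size[OF f] by blast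
  show ?thesis
  proof (rule ptimeI[where m = "max m n" and c = "Seq c d" and p = "1 + p + pcompose r q"])
    fix s a assume s: "s 0 = eA a" "\<And>i. 0 < i \<Longrightarrow> i < max m n \<Longrightarrow> s i = Leaf"
    have 1: "runs c s (s(0 := eB (f a))) (poly p (dsize (eA a)))"
      by (rule computesD[OF c]) (use s in auto)
    have "runs d (s(0 := eB (f a))) ((s(0 := eB (f a)))(0 := eC (g (f a))))
       (poly r (dsize (eB (f a))))"
      by (rule computesD[OF d]) (use s in auto)
    then have 2: "runs d (s(0 := eB (f a))) (s(0 := eC (g (f a))))
       (poly r (poly q (dsize (eA a))))"
      by (auto intro: runs_mono poly_nat_mono[OF q])
    show "runs (Seq c d) s (s(0 := eC (g (f a)))) (poly (1 + p + pcompose r q) (dsize (eA a)))"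
      using runs_Seq[OF 1 2] by (simp add: poly_pcompose)
  qed
qed

text \<open>Nested, it produces the same trees as \<open>enc_edge\<close> and \<open>enc_cc\<close>,
  so results on tuples carry over to instances without recoding.\<close>

fun enc_pair :: "('a \<Rightarrow> data) \<Rightarrow> ('b \<Rightarrow> data) \<Rightarrow> 'a \<times> 'b \<Rightarrow> data" where
  "enc_pair eA eB (a, b) = Node (eA a) (eB b)"

lemma ptime_id: "ptime eA eA (\<lambda>x. x)"
  by (rule ptime_expr[where e = "Var 0" and p = "[:0, 1:]"]) auto

lemma ptime_fst:
  assumes "ptime eA (enc_pair eB eC) f"
  shows "ptime eA eB (\<lambda>x. fst (f x))"
proof (rule ptime_comp[OF assms])
  show "ptime (enc_pair eB eC) eB fst"
    by (rule ptime_expr[where e = "Hd (Var 0)" and p = "[:0, 2:]"]) auto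
qed

lemma ptime_snd:
  assumes "ptime eA (enc_pair eB eC) f"
  shows "ptime eA eC (\<lambda>x. snd (f x))"
proof (rule ptime_comp[OF assms])
  show "ptime (enc_pair eB eC) eC snd"
    by (rule ptime_expr[where e = "Tl (Var 0)" and p = "[:0, 2:]"]) auto
qed

text \<open>Here \<open>g\<close> changes the type but not the tree, so the program for
  \<open>f\<close> already computes the composition.\<close>

lemma ptime_recode:
  assumes "ptime eA eB f" "\<And>a. eC (g (f a)) = eB (f a)"
  shows "ptime eA eC (\<lambda>x. g (f x))"
  using assms unfolding ptime_def computes_def by simp

lemma ptime_const: "ptime eA eB (\<lambda>_. b)"
proof -
  \<comment> \<open>\<open>lit d\<close> is the closed expression that rebuilds the tree
    \<open>d\<close>; its cost is the same in every store, hence a constant polynomial.\<close>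
  define lit where "lit = rec_data Nl (\<lambda>_ _. Cns)"
  have v: "val (lit d) s = d" for d s by (induction d) (auto simp: lit_def)
  have c: "cost (lit d) s = cost (lit d) s'" for d s s'
    by (induction d) (auto simp: lit_def v[unfolded lit_def])
  show ?thesis
    by (rule ptime_expr[where e = "lit (eB b)" and p = "[:cost (lit (eB b)) (\<lambda>_. Leaf):]"])
      (auto simp: v intro: c[THEN eq_imp_le])
qed

text \<open>Both programs expect the input in variable 0. Variable \<open>M\<close>, above the work
  variables of both, keeps a copy of it, and \<open>M + 1\<close> keeps the first result while the
  second program runs.\<close>

lemma ptime_Pair:
  assumes f: "ptime eA eB f" and g: "ptime eA eC g"
  shows "ptime eA (enc_pair eB eC) (\<lambda>x. (f x, g x))"
proof -
  obtain c m p where c: "computes c m p eA eB f"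
    using f unfolding ptime_def by blast
  obtain d n r where d: "computes d n r eA eC g"
    using g unfolding ptime_def by blast
  obtain q where q: "\<And>a. dsize (eB (f a)) \<le> poly q (dsize (eA a))"
    using ptime_output_size[OF f] by blast
  obtain u where u: "\<And>a. dsize (eC (g a)) \<le> poly u (dsize (eA a))"
    using ptime_output_size[OF g] by blast
  define M where "M = Suc (max m n)"
  have M: "M \<noteq> 0" "\<not> M < m" "\<not> M < n" "m \<le> M" "n \<le> M" unfolding M_def by auto
  let ?c = "Seq (Assign M (Var 0)) (Seq c (Seq (Assign (M+1) (Var 0)) (Seq (Assign 0 (Var M))
    (Seq d (Seq (Assign 0 (Cns (Var (M+1)) (Var 0)))
      (Seq (Assign M Nl) (Assign (M+1) Nl)))))))"
  show ?thesis
  proof (rule ptimeI[where m = "M + 2" and c = ?c and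
        p = "[:20, 2:] + p + r + smult 3 (q + u)"])
    fix s a assume s: "s 0 = eA a" "\<And>i. 0 < i \<Longrightarrow> i < M + 2 \<Longrightarrow> s i = Leaf"
    let ?x = "eA a" and ?y = "eB (f a)" and ?z = "eC (g a)"
    let ?N = "dsize ?x"
    let ?s1 = "s(M := ?x)"
    let ?s2 = "s(M := ?x, 0 := ?y)"
    let ?s3 = "s(M := ?x, 0 := ?y, M+1 := ?y)"
    let ?s4 = "s(M := ?x, M+1 := ?y, 0 := ?x)"
    let ?s5 = "s(M := ?x, M+1 := ?y, 0 := ?z)"
    let ?s6 = "s(M := ?x, M+1 := ?y, 0 := Node ?y ?z)"
    let ?s7 = "s(M+1 := ?y, 0 := Node ?y ?z)"
    have sM: "s M = Leaf" "s (Suc M) = Leaf" using s(2) M by auto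
    have 1: "runs (Assign M (Var 0)) s ?s1 (1 + ?N)"
      using runs_Assign[of "Var 0" s "1 + ?N" M] s by simp
    have 2: "runs c ?s1 ?s2 (poly p ?N)"
      by (rule computesD[OF c]) (use s M in auto)
    have 3: "runs (Assign (M+1) (Var 0)) ?s2 ?s3 (1 + dsize ?y)"
      using runs_Assign[of "Var 0" ?s2 "1 + dsize ?y" "M+1"] by simp
    have eq4: "?s4 = ?s3(0 := val (Var M) ?s3)" using M by (auto simp: fun_eq_iff)
    have 4: "runs (Assign 0 (Var M)) ?s3 ?s4 (1 + ?N)"
      unfolding eq4 by (rule runs_Assign) (use M in simp)
    have 5: "runs d ?s4 ?s5 (poly r ?N)"
    proof -
      have "runs d ?s4 (?s4(0 := ?z)) (poly r ?N)"
        by (rule computesD[OF d]) (use s M in auto)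
      then show ?thesis by simp
    qed
    have eq6: "?s6 = ?s5(0 := val (Cns (Var (M+1)) (Var 0)) ?s5)" using M by (auto simp: fun_eq_iff)
    have 6: "runs (Assign 0 (Cns (Var (M+1)) (Var 0))) ?s5 ?s6 (2 + 2 * dsize ?y + 2 * dsize ?z)"
      unfolding eq6 by (rule runs_Assign) simp
    have eq7: "?s7 = ?s6(M := val Nl ?s6)" using M sM by (auto simp: fun_eq_iff)
    have 7: "runs (Assign M Nl) ?s6 ?s7 2"
      unfolding eq7 by (rule runs_Assign) simp
    have eq8: "s(0 := Node ?y ?z) = ?s7(M+1 := val Nl ?s7)" using M sM by (auto simp: fun_eq_iff)
    have 8: "runs (Assign (M+1) Nl) ?s7 (s(0 := Node ?y ?z)) 2"
      unfolding eq8 by (rule runs_Assign) simp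
    have "runs ?c s (s(0 := Node ?y ?z)) (1 + (1 + ?N) + (1 + poly p ?N + (1 + (1 + dsize ?y) +
      (1 + (1 + ?N) + (1 + poly r ?N + (1 + (2 + 2 * dsize ?y + 2 * dsize ?z) + (1 + 2 + 2)))))))"
      by (intro runs_Seq[OF 1] runs_Seq[OF 2] runs_Seq[OF 3] runs_Seq[OF 4] runs_Seq[OF 5]
            runs_Seq[OF 6] runs_Seq[OF 7] 8)
    then show "runs ?c s (s(0 := enc_pair eB eC (f a, g a)))
       (poly ([:20, 2:] + p + r + smult 3 (q + u)) ?N)"
      by (rule runs_eq) (use q[of a] u[of a] in simp_all)
  qed
qed

text \<open>A binary function is shown polynomial once, on projections of a pair, and may then be
  used with any polynomial arguments.\<close>

lemma ptime_comp2:
  assumes "ptime (enc_pair eB eC) eD (\<lambda>p. h (fst p) (snd p))" "ptime eA eB f" "ptime eA eC g"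
  shows "ptime eA eD (\<lambda>x. h (f x) (g x))"
  using ptime_comp[OF ptime_Pair[OF assms(2,3)] assms(1)] by (simp only: fst_conv snd_conv)

text \<open>These are the two values of \<open>Eq\<close>, and \<open>Leaf\<close> is the only tree
  that tests as false.\<close>

fun enc_bool :: "bool \<Rightarrow> data" where
  "enc_bool True = Node Leaf Leaf"
| "enc_bool False = Leaf"

text \<open>The program compares trees, which decides equality of values only for an injective
  encoding.\<close>

lemma ptime_eq:
  assumes "inj eB" "ptime eA eB f" "ptime eA eB g"
  shows "ptime eA enc_bool (\<lambda>x. f x = g x)"
proof (rule ptime_comp2[where h = "(=)", OF _ assms(2,3)])
  show "ptime (enc_pair eB eB) enc_bool (\<lambda>p. fst p = snd p)"
    by (rule ptime_expr[where e = "Eq (Hd (Var 0)) (Tl (Var 0))" and p = "[:3, 4:]"])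
      (auto simp: inj_eq[OF assms(1)])
qed

text \<open>Both branches are computed and stored with the test, and only then is one
  selected.\<close>

lemma ptime_If:
  assumes b: "ptime eA enc_bool b" and f: "ptime eA eB f" and g: "ptime eA eB g"
  shows "ptime eA eB (\<lambda>x. if b x then f x else g x)"
proof -
  have sel: "ptime (enc_pair enc_bool (enc_pair eB eB)) eB
      (\<lambda>p. if fst p then fst (snd p) else snd (snd p))"
  proof (rule ptimeI[where m = 0 and p = "[:10, 10:]" and
        c = "If (Hd (Var 0)) (Assign 0 (Hd (Tl (Var 0)))) (Assign 0 (Tl (Tl (Var 0))))"])
    fix s :: store and a :: "bool \<times> 'b \<times> 'b"
    assume s: "s 0 = enc_pair enc_bool (enc_pair eB eB) a"
    obtain t x y where a: "a = (t, x, y)" by (cases a)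
    let ?N = "dsize (enc_pair enc_bool (enc_pair eB eB) a)"
    let ?r = "if t then eB x else eB y"
    have sz: "dsize (enc_bool t) + dsize (eB x) + dsize (eB y) + 2 = ?N" unfolding a by simp
    have "runs (If (Hd (Var 0)) (Assign 0 (Hd (Tl (Var 0)))) (Assign 0 (Tl (Tl (Var 0))))) s
      (s(0 := ?r)) (1 + cost (Hd (Var 0)) s + (1 + 4 * ?N))"
    proof (rule runs_If)
      assume "val (Hd (Var 0)) s \<noteq> Leaf"
      then have t by (cases t) (auto simp: s a)
      then show "runs (Assign 0 (Hd (Tl (Var 0)))) s (s(0 := ?r)) (1 + 4 * ?N)"
        using runs_Assign[of "Hd (Tl (Var 0))" s "1 + 4 * ?N" 0] by (simp add: s a)
    next
      assume "val (Hd (Var 0)) s = Leaf"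
      then have "\<not> t" by (cases t) (auto simp: s a)
      then show "runs (Assign 0 (Tl (Tl (Var 0)))) s (s(0 := ?r)) (1 + 4 * ?N)"
        using runs_Assign[of "Tl (Tl (Var 0))" s "1 + 4 * ?N" 0] by (simp add: s a)
    qed
    then show "runs (If (Hd (Var 0)) (Assign 0 (Hd (Tl (Var 0)))) (Assign 0 (Tl (Tl (Var 0))))) s
       (s(0 := eB (if fst a then fst (snd a) else snd (snd a)))) (poly [:10, 10:] ?N)"
      by (rule runs_eq) (use s sz in \<open>auto simp: a\<close>)
  qed
  show ?thesis
    using ptime_comp[OF ptime_Pair[OF b ptime_Pair[OF f g]] sel]
    by (simp only: fst_conv snd_conv cong: if_cong)
qed

lemma ptime_Not:
  assumes "ptime eA enc_bool f"
  shows "ptime eA enc_bool (\<lambda>x. \<not> f x)"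
proof -
  have "(\<lambda>x. \<not> f x) = (\<lambda>x. if f x then False else True)" by auto
  then show ?thesis
    using ptime_If[OF assms ptime_const[of _ _ False] ptime_const[of _ _ True]] by (simp only:)
qed

lemma ptime_conj:
  assumes "ptime eA enc_bool f" "ptime eA enc_bool g"
  shows "ptime eA enc_bool (\<lambda>x. f x \<and> g x)"
proof -
  have "(\<lambda>x. f x \<and> g x) = (\<lambda>x. if f x then g x else False)" by auto
  then show ?thesis using ptime_If[OF assms(1,2) ptime_const[of _ _ False]] by (simp only:)
qed

lemma ptime_disj:
  assumes "ptime eA enc_bool f" "ptime eA enc_bool g"
  shows "ptime eA enc_bool (\<lambda>x. f x \<or> g x)"
proof -
  have "(\<lambda>x. f x \<or> g x) = (\<lambda>x. if f x then True else g x)" by auto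
  then show ?thesis using ptime_If[OF assms(1) ptime_const[of _ _ True] assms(2)] by (simp only:)
qed

lemma ptime_Cons:
  assumes "ptime eA eB f" "ptime eA (enc_list eB) g"
  shows "ptime eA (enc_list eB) (\<lambda>x. f x # g x)"
  using ptime_Pair[OF assms] by (simp add: ptime_def computes_def)

section \<open>Bounded iteration over lists\<close>

lemma dsize_enc_list_elem: "y \<in> set ys \<Longrightarrow> dsize (e y) < dsize (enc_list e ys)"
  by (induction ys) auto

lemma length_less_dsize_enc_list: "length ys < dsize (enc_list e ys)"
  by (induction ys) auto

text \<open>Loop state: the environment is kept in variable \<open>M\<close>, the rest of the list in \<open>M + 1\<close> and the
  accumulator in \<open>M + 2\<close>.\<close>

lemma runs_fold_loop:
  fixes eA :: "'a \<Rightarrow> data" and eB :: "'b \<Rightarrow> data" and eC :: "'c \<Rightarrow> data"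
  assumes c: "computes c m p (enc_pair eA (enc_pair eB eC)) eC
       (\<lambda>z. step (fst z) (fst (snd z)) (snd (snd z)))"
    and M: "M \<noteq> 0" "m \<le> M" and s: "\<And>i. 0 < i \<Longrightarrow> i < M \<Longrightarrow> s i = Leaf"
    and x: "dsize (eA x) \<le> N"
  defines "body \<equiv> Seq (Assign 0 (Cns (Var M) (Cns (Hd (Var (M+1))) (Var (M+2)))))
      (Seq c (Seq (Assign (M+2) (Var 0)) (Assign (M+1) (Tl (Var (M+1))))))"
  shows "dsize (enc_list eB ys) \<le> N \<Longrightarrow>
     (\<And>j. j \<le> length ys \<Longrightarrow> dsize (eC (fold (step x) (take j ys) a)) \<le> N) \<Longrightarrow>
     \<exists>d'. runs (While (Var (M+1)) body)
       (s(M := eA x, M+1 := enc_list eB ys, M+2 := eC a, 0 := d))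
       (s(M := eA x, M+1 := Leaf, M+2 := eC (fold (step x) ys a), 0 := d'))
       ((length ys + 1) * (poly p (3 * N + 2) + 20 * N + 20))"
proof (induction ys arbitrary: a d)
  case Nil
  let ?s = "s(M := eA x, M+1 := enc_list eB [], M+2 := eC a, 0 := d)"
  have *: "runs (While (Var (M+1)) body) ?s ?s (1 + cost (Var (M+1)) ?s)"
    by (rule runs_While_done) simp
  \<comment> \<open>For the empty list variable 0 keeps \<open>d\<close>, otherwise it holds the
    last result of \<open>c\<close>; hence the existential \<open>d'\<close>.\<close>
  show ?case
    by (rule exI[of _ d], rule runs_eq[OF *]) (simp_all add: fun_eq_iff)
next
  case (Cons y ys)
  let ?a' = "step x y a"
  let ?y = "eB y" and ?ys = "enc_list eB ys"
  let ?s0 = "s(M := eA x, M+1 := Node ?y ?ys, M+2 := eC a, 0 := d)"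
  let ?s1 = "s(M := eA x, M+1 := Node ?y ?ys, M+2 := eC a, 0 := Node (eA x) (Node ?y (eC a)))"
  let ?s2 = "s(M := eA x, M+1 := Node ?y ?ys, M+2 := eC a, 0 := eC ?a')"
  let ?s3 = "s(M := eA x, M+1 := Node ?y ?ys, M+2 := eC ?a', 0 := eC ?a')"
  let ?s4 = "s(M := eA x, M+1 := ?ys, M+2 := eC ?a', 0 := eC ?a')"
  have N: "1 + dsize ?y + dsize ?ys \<le> N" "dsize (eC a) \<le> N" "dsize (eC ?a') \<le> N"
    using Cons.prems(1) Cons.prems(2)[of 0] Cons.prems(2)[of 1] by auto
  have eq1: "?s1 = ?s0(0 := val (Cns (Var M) (Cns (Hd (Var (M+1))) (Var (M+2)))) ?s0)"
    using M by (auto simp: fun_eq_iff)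
  have 1: "runs (Assign 0 (Cns (Var M) (Cns (Hd (Var (M+1))) (Var (M+2))))) ?s0 ?s1 (10 * N + 5)"
    unfolding eq1 by (rule runs_Assign) (use M N x in simp)
  have "runs c ?s1 (?s1(0 := eC ?a')) (poly p (dsize (Node (eA x) (Node ?y (eC a)))))"
    using computesD[OF c, of ?s1 "(x, y, a)"] M s by simp
  \<comment> \<open>The triple given to \<open>c\<close> consists of two nodes and three components
    of size at most \<open>N\<close>.\<close>
  then have 2: "runs c ?s1 ?s2 (poly p (3 * N + 2))"
    by (rule runs_eq) (use N x in \<open>simp_all add: poly_nat_mono\<close>)
  have eq3: "?s3 = ?s2(M+2 := val (Var 0) ?s2)" using M by (auto simp: fun_eq_iff)
  have 3: "runs (Assign (M+2) (Var 0)) ?s2 ?s3 (N + 1)"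
    unfolding eq3 by (rule runs_Assign) (use M N in simp)
  have eq4: "?s4 = ?s3(M+1 := val (Tl (Var (M+1))) ?s3)" using M by (auto simp: fun_eq_iff)
  have 4: "runs (Assign (M+1) (Tl (Var (M+1)))) ?s3 ?s4 (2 * N + 1)"
    unfolding eq4 by (rule runs_Assign) (use M N in simp)
  have body: "runs body ?s0 ?s4
      (1 + (10 * N + 5) + (1 + poly p (3 * N + 2) + (1 + (N + 1) + (2 * N + 1))))"
    unfolding body_def by (intro runs_Seq[OF 1] runs_Seq[OF 2] runs_Seq[OF 3] 4)
  have "\<exists>d'. runs (While (Var (M+1)) body) ?s4
       (s(M := eA x, M+1 := Leaf, M+2 := eC (fold (step x) ys ?a'), 0 := d'))
       ((length ys + 1) * (poly p (3 * N + 2) + 20 * N + 20))"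
  proof (rule Cons.IH)
    show "dsize ?ys \<le> N" using N by simp
    show "dsize (eC (fold (step x) (take j ys) ?a')) \<le> N" if "j \<le> length ys" for j
      using Cons.prems(2)[of "Suc j"] that by simp
  qed
  then obtain d' where d': "runs (While (Var (M+1)) body) ?s4
       (s(M := eA x, M+1 := Leaf, M+2 := eC (fold (step x) ys ?a'), 0 := d'))
       ((length ys + 1) * (poly p (3 * N + 2) + 20 * N + 20))" by blast
  have nl: "val (Var (M+1)) ?s0 \<noteq> Leaf" using M by simp
  have "cost (Var (M+1)) ?s0 \<le> N" using N M by simp
  then have t: "1 + cost (Var (M+1)) ?s0 +
       (1 + (10 * N + 5) + (1 + poly p (3 * N + 2) + (1 + (N + 1) + (2 * N + 1)))) +
       (length ys + 1) * (poly p (3 * N + 2) + 20 * N + 20)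
     \<le> (length (y # ys) + 1) * (poly p (3 * N + 2) + 20 * N + 20)"
    by (simp add: algebra_simps)
  have "runs (While (Var (M+1)) body) ?s0
       (s(M := eA x, M+1 := Leaf, M+2 := eC (fold (step x) (y # ys) a), 0 := d'))
       ((length (y # ys) + 1) * (poly p (3 * N + 2) + 20 * N + 20))"
    by (rule runs_eq[OF runs_While_step[OF nl body d'] _ t]) (simp only: fold_simps)
  then show ?case
    by (simp only: enc_list.simps) (rule exI)
qed

text \<open>Polynomial steps alone would not do: an accumulator that doubles in each round becomes
  exponential. Hence the bound on the accumulator after every prefix.\<close>

lemma ptime_fold:
  fixes eA :: "'a \<Rightarrow> data" and eB :: "'b \<Rightarrow> data" and eC :: "'c \<Rightarrow> data"
  assumes xs: "ptime eA (enc_list eB) xs" and init: "ptime eA eC init"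
    and step: "ptime (enc_pair eA (enc_pair eB eC)) eC
       (\<lambda>z. step (fst z) (fst (snd z)) (snd (snd z)))"
    and bound: "\<And>x j. j \<le> length (xs x) \<Longrightarrow>
       dsize (eC (fold (step x) (take j (xs x)) (init x))) \<le> poly q (dsize (eA x))"
  shows "ptime eA eC (\<lambda>x. fold (step x) (xs x) (init x))"
proof -
  obtain c m p where c: "computes c m p (enc_pair eA (enc_pair eB eC)) eC
       (\<lambda>z. step (fst z) (fst (snd z)) (snd (snd z)))"
    using step unfolding ptime_def by blast
  obtain u where u: "\<And>x. dsize (enc_pair eA (enc_pair (enc_list eB) eC) (x, xs x, init x))
      \<le> poly u (dsize (eA x))"
    using ptime_output_size[OF ptime_Pair[OF ptime_id ptime_Pair[OF xs init]]] by blast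
  obtain c0 m0 p0 where c0: "computes c0 m0 p0 eA
       (enc_pair eA (enc_pair (enc_list eB) eC)) (\<lambda>x. (x, xs x, init x))"
    using ptime_Pair[OF ptime_id ptime_Pair[OF xs init]] unfolding ptime_def by blast
  define M where "M = Suc (max m m0)"
  have M: "M \<noteq> 0" "m \<le> M" "m0 \<le> M" unfolding M_def by auto
  define body where "body \<equiv> Seq (Assign 0 (Cns (Var M) (Cns (Hd (Var (M+1))) (Var (M+2)))))
      (Seq c (Seq (Assign (M+2) (Var 0)) (Assign (M+1) (Tl (Var (M+1))))))"
  let ?c = "Seq c0 (Seq (Assign M (Hd (Var 0))) (Seq (Assign (M+1) (Hd (Tl (Var 0))))
     (Seq (Assign (M+2) (Tl (Tl (Var 0)))) (Seq (While (Var (M+1)) body)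
     (Seq (Assign 0 (Var (M+2))) (Seq (Assign M Nl) (Assign (M+2) Nl)))))))"
  \<comment> \<open>\<open>w\<close> bounds the accumulators and the initial triple;
    \<open>L\<close> is the time of \<open>runs_fold_loop\<close> with \<open>N\<close> the value of
    \<open>w\<close> at the input size and the list length replaced by \<open>N\<close>.\<close>
  define w where "w = q + u"
  define L where "L = (w + 1) * (pcompose p (smult 3 w + [:2:]) + smult 20 w + [:20:])"
  show ?thesis
  proof (rule ptimeI[where m = "M + 3" and c = ?c and p = "p0 + L + smult 20 w + [:20:]"])
    fix s x assume s: "s 0 = eA x" "\<And>i. 0 < i \<Longrightarrow> i < M + 3 \<Longrightarrow> s i = Leaf"
    let ?n = "dsize (eA x)"
    define N where "N = poly w ?n"
    let ?x = "eA x" and ?l = "enc_list eB (xs x)" and ?i = "eC (init x)"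
    let ?r = "eC (fold (step x) (xs x) (init x))"
    let ?t = "Node ?x (Node ?l ?i)"
    have N: "2 + dsize ?x + dsize ?l + dsize ?i \<le> N"
      "\<And>j. j \<le> length (xs x) \<Longrightarrow> dsize (eC (fold (step x) (take j (xs x)) (init x))) \<le> N"
      using u[of x] bound[of _ x] unfolding N_def w_def by (auto intro: trans_le_add1)
    have Nr: "dsize ?r \<le> N" using N(2)[of "length (xs x)"] by simp
    have sM: "s M = Leaf" "s (Suc M) = Leaf" "s (Suc (Suc M)) = Leaf" using s(2) M by auto
    have 0: "runs c0 s (s(0 := ?t)) (poly p0 ?n)"
      using computesD[OF c0, of s x] s M by simp
    let ?s1 = "s(0 := ?t, M := ?x)"
    have eq1: "?s1 = (s(0 := ?t))(M := val (Hd (Var 0)) (s(0 := ?t)))" by simp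
    have 1: "runs (Assign M (Hd (Var 0))) (s(0 := ?t)) ?s1 (2 * N + 1)"
      unfolding eq1 by (rule runs_Assign) (use N in simp)
    let ?s2 = "s(0 := ?t, M := ?x, M+1 := ?l)"
    have eq2: "?s2 = ?s1(M+1 := val (Hd (Tl (Var 0))) ?s1)" using M by simp
    have 2: "runs (Assign (M+1) (Hd (Tl (Var 0)))) ?s1 ?s2 (3 * N + 1)"
      unfolding eq2 by (rule runs_Assign) (use N M in simp)
    let ?s3 = "s(M := ?x, M+1 := ?l, M+2 := ?i, 0 := ?t)"
    have eq3: "?s3 = ?s2(M+2 := val (Tl (Tl (Var 0))) ?s2)" using M by (auto simp: fun_eq_iff)
    have 3: "runs (Assign (M+2) (Tl (Tl (Var 0)))) ?s2 ?s3 (3 * N + 1)"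
      unfolding eq3 by (rule runs_Assign) (use N M in simp)
    have "\<exists>d'. runs (While (Var (M+1)) body) ?s3 (s(M := ?x, M+1 := Leaf, M+2 := ?r, 0 := d'))
       ((length (xs x) + 1) * (poly p (3 * N + 2) + 20 * N + 20))"
      unfolding body_def by (rule runs_fold_loop[OF c]) (use M s N in auto)
    then obtain d' where d': "runs (While (Var (M+1)) body) ?s3
       (s(M := ?x, M+1 := Leaf, M+2 := ?r, 0 := d'))
       ((length (xs x) + 1) * (poly p (3 * N + 2) + 20 * N + 20))" by blast
    have "(length (xs x) + 1) * (poly p (3 * N + 2) + 20 * N + 20)
        \<le> (N + 1) * (poly p (3 * N + 2) + 20 * N + 20)"
      using length_less_dsize_enc_list[of "xs x" eB] N by (intro mult_right_mono) auto
    moreover have "(N + 1) * (poly p (3 * N + 2) + 20 * N + 20) = poly L ?n"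
      unfolding N_def L_def by (simp add: poly_pcompose)
    ultimately have tL: "(length (xs x) + 1) * (poly p (3 * N + 2) + 20 * N + 20) \<le> poly L ?n"
      by linarith
    have 4: "runs (While (Var (M+1)) body) ?s3
       (s(M := ?x, M+1 := Leaf, M+2 := ?r, 0 := d')) (poly L ?n)"
      by (rule runs_mono[OF d' tL])
    let ?s4 = "s(M := ?x, M+1 := Leaf, M+2 := ?r, 0 := d')"
    let ?s5 = "s(M := ?x, M+1 := Leaf, M+2 := ?r, 0 := ?r)"
    let ?s6 = "s(M+2 := ?r, 0 := ?r)"
    have eq5: "?s5 = ?s4(0 := val (Var (M+2)) ?s4)" using M by (auto simp: fun_eq_iff)
    have 5: "runs (Assign 0 (Var (M+2))) ?s4 ?s5 (N + 1)"
      unfolding eq5 by (rule runs_Assign) (use Nr M in simp)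
    \<comment> \<open>The loop itself leaves \<open>M + 1\<close> empty; the other two work
      variables are cleared here and below.\<close>
    have eq6: "?s6 = ?s5(M := val Nl ?s5)" using M sM by (auto simp: fun_eq_iff)
    have 6: "runs (Assign M Nl) ?s5 ?s6 2"
      unfolding eq6 by (rule runs_Assign) simp
    have eq7: "s(0 := ?r) = ?s6(M+2 := val Nl ?s6)" using M sM by (auto simp: fun_eq_iff)
    have 7: "runs (Assign (M+2) Nl) ?s6 (s(0 := ?r)) 2"
      unfolding eq7 by (rule runs_Assign) simp
    have "runs ?c s (s(0 := ?r)) (1 + poly p0 ?n + (1 + (2 * N + 1) + (1 + (3 * N + 1) +
      (1 + (3 * N + 1) + (1 + poly L ?n + (1 + (N + 1) + (1 + 2 + 2)))))))"
      by (intro runs_Seq[OF 0] runs_Seq[OF 1] runs_Seq[OF 2] runs_Seq[OF 3] runs_Seq[OF 4]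
            runs_Seq[OF 5] runs_Seq[OF 6] 7)
    then show "runs ?c s (s(0 := ?r)) (poly (p0 + L + smult 20 w + [:20:]) ?n)"
      by (rule runs_mono) (simp add: N_def)
  qed
qed

lemma dsize_enc_nat: "dsize (enc_nat n) = 2 * n + 1"
  by (induction n) auto

text \<open>If the growth in one round depends on the environment and the list element but not on
  the accumulator, the total is at most the number of rounds times a polynomial.\<close>

lemma ptime_fold_add:
  fixes eA :: "'a \<Rightarrow> data" and eB :: "'b \<Rightarrow> data" and eC :: "'c \<Rightarrow> data"
  assumes xs: "ptime eA (enc_list eB) xs" and init: "ptime eA eC init"
    and step: "ptime (enc_pair eA (enc_pair eB eC)) eC
       (\<lambda>z. step (fst z) (fst (snd z)) (snd (snd z)))"
    and growth: "\<And>x b a. dsize (eC (step x b a)) \<le> dsize (eC a) + poly q (dsize (eA x) + dsize (eB b))"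
  shows "ptime eA eC (\<lambda>x. fold (step x) (xs x) (init x))"
proof -
  obtain u where u: "\<And>x. dsize (eC (init x)) \<le> poly u (dsize (eA x))"
    using ptime_output_size[OF init] by blast
  obtain w where w: "\<And>x. dsize (enc_list eB (xs x)) \<le> poly w (dsize (eA x))"
    using ptime_output_size[OF xs] by blast
  have "dsize (eC (fold (step x) (take j (xs x)) (init x)))
      \<le> poly (u + w * pcompose q ([:0, 1:] + w)) (dsize (eA x))" if "j \<le> length (xs x)" for x j
  proof -
    let ?n = "dsize (eA x)"
    let ?Q = "poly q (?n + poly w ?n)"
    have el: "poly q (?n + dsize (eB b)) \<le> ?Q" if "b \<in> set (xs x)" for b
      using dsize_enc_list_elem[OF that, of eB] w[of x] by (intro poly_nat_mono) linarith
    \<comment> \<open>Stated for all lists with entries from \<open>xs x\<close>, so that it applies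
      to each prefix.\<close>
    have "dsize (eC (fold (step x) ys a)) \<le> dsize (eC a) + length ys * ?Q"
      if "set ys \<subseteq> set (xs x)" for ys a
      using that
    proof (induction ys arbitrary: a)
      case (Cons y ys)
      have "dsize (eC (fold (step x) (y # ys) a)) \<le> dsize (eC (step x y a)) + length ys * ?Q"
        using Cons.IH[of "step x y a"] Cons.prems by simp
      also have "\<dots> \<le> dsize (eC a) + ?Q + length ys * ?Q"
        using growth[of x y a] el[of y] Cons.prems by simp
      finally show ?case by simp
    qed simp
    from this[of "take j (xs x)" "init x"] have "dsize (eC (fold (step x) (take j (xs x)) (init x)))
        \<le> dsize (eC (init x)) + length (take j (xs x)) * ?Q"
      by (simp add: set_take_subset)
    also have "\<dots> \<le> poly u ?n + poly w ?n * ?Q"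
      using u[of x] w[of x] length_less_dsize_enc_list[of "xs x" eB]
      by (intro add_mono mult_right_mono) auto
    finally show ?thesis by (simp add: poly_pcompose)
  qed
  then show ?thesis by (rule ptime_fold[OF xs init step])
qed

section \<open>Unary arithmetic and list functions\<close>

lemma ptime_Suc: "ptime eA enc_nat f \<Longrightarrow> ptime eA enc_nat (\<lambda>x. Suc (f x))"
  by (erule ptime_comp, rule ptime_expr[where e = "Cns Nl (Var 0)" and p = "[:3, 2:]"]) auto

lemma ptime_diff_1: "ptime eA enc_nat f \<Longrightarrow> ptime eA enc_nat (\<lambda>x. f x - 1)"
proof (erule ptime_comp, rule ptime_expr[where e = "Tl (Var 0)" and p = "[:0, 2:]"])
  fix s :: store and n assume "s 0 = enc_nat n"
  then show "val (Tl (Var 0)) s = enc_nat (n - 1)" "cost (Tl (Var 0)) s \<le> poly [:0, 2:] (dsize (enc_nat n))"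
    by (cases n; simp)+
qed

text \<open>A unary number is the same tree as a list of units, which turns folds into counting
  loops.\<close>

lemma ptime_replicate:
  "ptime eA enc_nat f \<Longrightarrow> ptime eA (enc_list (\<lambda>_::unit. Leaf)) (\<lambda>x. replicate (f x) ())"
proof (erule ptime_recode)
  show "enc_list (\<lambda>_::unit. Leaf) (replicate n ()) = enc_nat n" for n
    by (induction n) auto
qed

text \<open>Folding with cons builds lists backwards; \<open>ptime_map\<close>,
  \<open>ptime_filter\<close> and \<open>ptime_upt\<close> use this to restore the order.\<close>

lemma ptime_rev:
  assumes "ptime eA (enc_list eB) xs"
  shows "ptime eA (enc_list eB) (\<lambda>x. rev (xs x))"
proof -
  have "ptime eA (enc_list eB) (\<lambda>x. fold (\<lambda>b a. b # a) (xs x) [])"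
    by (rule ptime_fold_add[where q = "[:1, 1:]" and step = "\<lambda>_ b a. b # a"])
      (auto intro!: assms ptime_const ptime_Cons ptime_fst ptime_snd ptime_id)
  moreover have "fold (\<lambda>b a. b # a) ys zs = rev ys @ zs" for ys zs :: "'b list"
    by (induction ys arbitrary: zs) auto
  ultimately show ?thesis by simp
qed

lemma ptime_length:
  assumes "ptime eA (enc_list eB) xs"
  shows "ptime eA enc_nat (\<lambda>x. length (xs x))"
proof -
  have "ptime eA enc_nat (\<lambda>x. fold (\<lambda>b a. Suc a) (xs x) 0)"
    by (rule ptime_fold_add[where q = "[:2:]" and step = "\<lambda>_ b a. Suc a" and eB = eB])
      (auto intro!: assms ptime_const ptime_Suc ptime_snd[where eB = eB]
        ptime_snd[where eB = eA] ptime_id)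
  moreover have "fold (\<lambda>b a. Suc a) ys n = length ys + n" for ys :: "'b list" and n
    by (induction ys arbitrary: n) auto
  ultimately show ?thesis by simp
qed

lemma ptime_map:
  assumes xs: "ptime eA (enc_list eB) xs"
    and g: "ptime (enc_pair eA eB) eC (\<lambda>z. g (fst z) (snd z))"
  shows "ptime eA (enc_list eC) (\<lambda>x. map (g x) (xs x))"
proof -
  obtain q where "\<And>z. dsize (eC (g (fst z) (snd z))) \<le> poly q (dsize (enc_pair eA eB z))"
    using ptime_output_size[OF g] by blast
  \<comment> \<open>A pair is one node larger than its components together, hence the substitution
    of \<open>[:1, 1:]\<close>.\<close>
  then have q: "dsize (eC (g x b)) \<le> poly (pcompose q [:1, 1:]) (dsize (eA x) + dsize (eB b))" for x b
    by (metis (no_types) fst_conv snd_conv enc_pair.simps dsize.simps(2) poly_pcompose add.assoc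
        poly_pCons poly_0 mult_1_right mult_zero_right add_0_right)
  have "ptime eA (enc_list eC) (\<lambda>x. fold (\<lambda>b a. g x b # a) (xs x) [])"
  proof (rule ptime_fold_add[where q = "1 + pcompose q [:1, 1:]" and step = "\<lambda>x b a. g x b # a"])
    show "ptime (enc_pair eA (enc_pair eB (enc_list eC))) (enc_list eC)
       (\<lambda>z. g (fst z) (fst (snd z)) # snd (snd z))"
      by (rule ptime_Cons ptime_comp2[OF g])+ (rule ptime_fst ptime_snd ptime_id)+
    show "dsize (enc_list eC (g x b # a)) \<le> dsize (enc_list eC a) +
       poly (1 + pcompose q [:1, 1:]) (dsize (eA x) + dsize (eB b))" for x b a
      using q[of x b] by simp
  qed (rule xs ptime_const)+
  moreover have "fold (\<lambda>b a. g x b # a) ys zs = rev (map (g x) ys) @ zs" for x ys zs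
    by (induction ys arbitrary: zs) auto
  ultimately have "ptime eA (enc_list eC) (\<lambda>x. rev (map (g x) (xs x)))" by simp
  from ptime_rev[OF this] show ?thesis by simp
qed

lemma ptime_filter:
  assumes xs: "ptime eA (enc_list eB) xs"
    and P: "ptime (enc_pair eA eB) enc_bool (\<lambda>z. P (fst z) (snd z))"
  shows "ptime eA (enc_list eB) (\<lambda>x. filter (P x) (xs x))"
proof -
  have "ptime eA (enc_list eB) (\<lambda>x. fold (\<lambda>b a. if P x b then b # a else a) (xs x) [])"
  proof (rule ptime_fold_add[where q = "[:1, 1:]" and step = "\<lambda>x b a. if P x b then b # a else a"])
    show "ptime (enc_pair eA (enc_pair eB (enc_list eB))) (enc_list eB)
       (\<lambda>z. if P (fst z) (fst (snd z)) then fst (snd z) # snd (snd z) else snd (snd z))"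
      by (rule ptime_If ptime_Cons ptime_comp2[OF P] ptime_fst ptime_snd ptime_id)+
  qed (auto intro: xs ptime_const)
  moreover have "fold (\<lambda>b a. if P x b then b # a else a) ys zs = rev (filter (P x) ys) @ zs" for x ys zs
    by (induction ys arbitrary: zs) auto
  ultimately have "ptime eA (enc_list eB) (\<lambda>x. rev (filter (P x) (xs x)))" by simp
  from ptime_rev[OF this] show ?thesis by simp
qed

lemma ptime_append:
  assumes "ptime eA (enc_list eB) xs" "ptime eA (enc_list eB) ys"
  shows "ptime eA (enc_list eB) (\<lambda>x. xs x @ ys x)"
proof -
  have "ptime eA (enc_list eB) (\<lambda>x. fold (\<lambda>b a. b # a) (rev (xs x)) (ys x))"
    by (rule ptime_fold_add[where q = "[:1, 1:]" and step = "\<lambda>_ b a. b # a"])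
      (auto intro!: assms ptime_rev ptime_Cons ptime_fst ptime_snd ptime_id)
  moreover have "fold (\<lambda>b a. b # a) us vs = rev us @ vs" for us vs :: "'b list"
    by (induction us arbitrary: vs) auto
  ultimately show ?thesis by simp
qed

lemma ptime_add:
  assumes "ptime eA enc_nat f" "ptime eA enc_nat g"
  shows "ptime eA enc_nat (\<lambda>x. f x + g x)"
proof -
  have "ptime eA enc_nat (\<lambda>x. fold (\<lambda>b a. Suc a) (replicate (f x) ()) (g x))"
    by (rule ptime_fold_add[where q = "[:2:]" and step = "\<lambda>_ b a. Suc a"
          and eB = "\<lambda>_. Leaf"])
      (auto intro!: assms ptime_replicate ptime_Suc ptime_snd[where eB = "\<lambda>_. Leaf"]
        ptime_snd[where eB = eA] ptime_id)
  moreover have "fold (\<lambda>b a. Suc a) (replicate m ()) n = m + n" for m n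
    by (induction m arbitrary: n) auto
  ultimately show ?thesis by simp
qed

lemma ptime_diff:
  assumes "ptime eA enc_nat f" "ptime eA enc_nat g"
  shows "ptime eA enc_nat (\<lambda>x. f x - g x)"
proof -
  have "ptime eA enc_nat (\<lambda>x. fold (\<lambda>b a. a - 1) (replicate (g x) ()) (f x))"
    by (rule ptime_fold_add[where q = "0" and step = "\<lambda>_ b a. a - 1"
          and eB = "\<lambda>_. Leaf"])
      (auto intro!: assms ptime_replicate ptime_diff_1 ptime_snd[where eB = "\<lambda>_. Leaf"]
        ptime_snd[where eB = eA] ptime_id simp: dsize_enc_nat simp del: One_nat_def)
  moreover have "fold (\<lambda>b a. a - 1) (replicate m ()) n = n - m" for m n
    by (induction m arbitrary: n) auto
  ultimately show ?thesis by simp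
qed

lemma ptime_mult:
  assumes "ptime eA enc_nat f" "ptime eA enc_nat g"
  shows "ptime eA enc_nat (\<lambda>x. f x * g x)"
proof -
  have 1: "ptime (enc_pair enc_nat enc_nat) enc_nat
      (\<lambda>x. fold (\<lambda>b a. a + snd x) (replicate (fst x) ()) 0)"
  proof (rule ptime_fold_add[where q = "[:0, 1:]" and step = "\<lambda>x b a. a + snd x"
        and eB = "\<lambda>_. Leaf"])
    show "ptime (enc_pair (enc_pair enc_nat enc_nat) (enc_pair (\<lambda>_::unit. Leaf) enc_nat)) enc_nat
      (\<lambda>z. snd (snd z) + snd (fst z))"
      by (rule ptime_add ptime_fst ptime_snd ptime_id)+
  qed (auto intro!: ptime_replicate ptime_fst ptime_id ptime_const simp: dsize_enc_nat)
  have "fold (\<lambda>b a. a + n) (replicate m ()) k = m * n + k" for m n k :: nat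
    by (induction m arbitrary: k) auto
  with 1 have "ptime (enc_pair enc_nat enc_nat) enc_nat (\<lambda>p. fst p * snd p)" by simp
  from ptime_comp2[OF this assms] show ?thesis .
qed

lemma inj_enc_nat: "inj enc_nat"
  by (auto simp: inj_def enc_nat_inj)

lemmas ptime_nat_eq = ptime_eq[OF inj_enc_nat]

lemma ptime_nat_le:
  assumes "ptime eA enc_nat f" "ptime eA enc_nat g"
  shows "ptime eA enc_bool (\<lambda>x. f x \<le> g x)"
  using ptime_nat_eq[OF ptime_diff[OF assms] ptime_const[of _ _ 0]] by simp

lemma ptime_nat_less:
  assumes "ptime eA enc_nat f" "ptime eA enc_nat g"
  shows "ptime eA enc_bool (\<lambda>x. f x < g x)"
  using ptime_Not[OF ptime_nat_le[OF assms(2,1)]] by (simp add: not_le)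

text \<open>Each round prepends the current length. This growth depends on the accumulator, so
  \<open>ptime_fold\<close> is applied directly with an explicit quadratic bound.\<close>

lemma ptime_upt:
  assumes "ptime eA enc_nat f"
  shows "ptime eA (enc_list enc_nat) (\<lambda>x. [0..<f x])"
proof -
  obtain u where u: "\<And>x. dsize (enc_nat (f x)) \<le> poly u (dsize (eA x))"
    using ptime_output_size[OF assms] by blast
  have f: "fold (\<lambda>b a. length a # a) (replicate j ()) [] = rev [0..<j]" for j
  proof (induction j)
    case (Suc j)
    have "replicate (Suc j) () = replicate j () @ [()]" by (simp add: replicate_append_same)
    then show ?case using Suc by simp
  qed simp
  have sz: "dsize (enc_list enc_nat (rev [0..<j])) \<le> 1 + j * (2 * j + 2)" for j
    by (induction j) (auto simp: dsize_enc_nat)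
  have "ptime eA (enc_list enc_nat)
      (\<lambda>x. fold (\<lambda>b a. length a # a) (replicate (f x) ()) [])"
  proof (rule ptime_fold[where q = "1 + u * (smult 2 u + [:2:])" and step = "\<lambda>x b a. length a # a"
        and eB = "\<lambda>_. Leaf"])
    show "ptime (enc_pair eA (enc_pair (\<lambda>_::unit. Leaf) (enc_list enc_nat))) (enc_list enc_nat)
       (\<lambda>z. length (snd (snd z)) # snd (snd z))"
      by (rule ptime_Cons ptime_length ptime_fst ptime_snd ptime_id)+
    fix x j assume "j \<le> length (replicate (f x) ())"
    then have j: "j \<le> f x" by simp
    then have "dsize (enc_list enc_nat (fold (\<lambda>b a. length a # a) (take j (replicate (f x) ())) []))
      \<le> 1 + j * (2 * j + 2)" using f[of j] sz[of j] by (simp add: min_def)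
    also have "\<dots> \<le> 1 + poly u (dsize (eA x)) * (2 * poly u (dsize (eA x)) + 2)"
      using j u[of x] by (intro add_mono mult_mono) (auto simp: dsize_enc_nat)
    finally show "dsize (enc_list enc_nat (fold (\<lambda>b a. length a # a) (take j (replicate (f x) ())) []))
      \<le> poly (1 + u * (smult 2 u + [:2:])) (dsize (eA x))" by simp
  qed (rule ptime_replicate[OF assms] ptime_const)+
  then have "ptime eA (enc_list enc_nat) (\<lambda>x. rev [0..<f x])" using f by simp
  from ptime_rev[OF this] show ?thesis by simp
qed

lemma ptime_nat_member:
  assumes "ptime eA enc_nat f" "ptime eA (enc_list enc_nat) xs"
  shows "ptime eA enc_bool (\<lambda>x. f x \<in> set (xs x))"
proof -
  have "ptime (enc_pair enc_nat (enc_list enc_nat)) enc_bool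
     (\<lambda>p. 0 < length (filter (\<lambda>y. y = fst p) (snd p)))"
    by (rule ptime_nat_less ptime_const ptime_length ptime_filter ptime_nat_eq
        ptime_fst ptime_snd ptime_id)+
  then have "ptime (enc_pair enc_nat (enc_list enc_nat)) enc_bool (\<lambda>p. fst p \<in> set (snd p))"
    by (simp add: filter_empty_conv)
  from ptime_comp2[OF this assms] show ?thesis .
qed

lemmas ptime_intros = ptime_id ptime_fst ptime_snd ptime_Pair ptime_const ptime_If ptime_Not
  ptime_conj ptime_disj ptime_nat_eq ptime_nat_le ptime_nat_less ptime_Suc ptime_add ptime_mult
  ptime_length ptime_map ptime_filter ptime_append ptime_upt ptime_nat_member

lemma ptime_comp3:
  assumes "ptime (enc_pair eB (enc_pair eC eD)) eE (\<lambda>p. h (fst p) (fst (snd p)) (snd (snd p)))"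
    "ptime eA eB f" "ptime eA eC g" "ptime eA eD k"
  shows "ptime eA eE (\<lambda>x. h (f x) (g x) (k x))"
  using ptime_comp[OF ptime_Pair[OF assms(2) ptime_Pair[OF assms(3,4)]] assms(1)]
  by (simp only: fst_conv snd_conv)

section \<open>The kernelization algorithm\<close>

type_synonym edges = "(nat \<times> nat \<times> nat) list"

abbreviation enc_edges :: "edges \<Rightarrow> data" where
  "enc_edges \<equiv> enc_list (enc_pair enc_nat (enc_pair enc_nat enc_nat))"

text \<open>Projections instead of tuple patterns, here and below, match the form of the
  \<open>ptime\<close> rules.\<close>

definition coloured_at :: "nat \<Rightarrow> nat \<Rightarrow> nat \<times> nat \<times> nat \<Rightarrow> bool" where
  "coloured_at v c e \<longleftrightarrow> (fst e = v \<or> fst (snd e) = v) \<and> snd (snd e) = c"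

definition colour_degree :: "edges \<Rightarrow> nat \<Rightarrow> nat \<Rightarrow> nat" where
  "colour_degree E v c = length (filter (coloured_at v c) E)"

text \<open>Ties count: a star of equal size serves the exchange just as well, and a least frequent
  colour then has all other colours present at \<open>v\<close> as rivals.\<close>

definition rivals :: "nat \<Rightarrow> edges \<Rightarrow> nat \<Rightarrow> nat \<Rightarrow> nat" where
  "rivals q E v c =
     length (filter (\<lambda>d. d \<noteq> c \<and> colour_degree E v c \<le> colour_degree E v d) [0..<q])"

definition prune :: "nat \<Rightarrow> nat \<Rightarrow> nat \<Rightarrow> nat \<Rightarrow> edges \<Rightarrow> edges" where
  "prune q k v c E =
     (if rivals q E v c \<le> 2 * k then E else filter (\<lambda>e. \<not> coloured_at v c e) E)"

definition prune_vertex :: "nat \<Rightarrow> nat \<Rightarrow> nat \<Rightarrow> edges \<Rightarrow> edges" where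
  "prune_vertex q k v = fold (prune q k v) [0..<q]"

definition prune_all :: "nat \<Rightarrow> nat \<Rightarrow> nat \<Rightarrow> edges \<Rightarrow> edges" where
  "prune_all n q k = fold (prune_vertex q k) [0..<n]"

text \<open>On the entries of \<open>xs\<close> this is the gapless renumbering in increasing order;
  at a strict upper bound of them it is the number of distinct entries, that is, the new vertex or
  colour count.\<close>

definition rank :: "nat list \<Rightarrow> nat \<Rightarrow> nat" where
  "rank xs v = length (filter (\<lambda>u. u \<in> set xs) [0..<v])"

definition endpoints :: "edges \<Rightarrow> nat list" where
  "endpoints E = map fst E @ map (\<lambda>e. fst (snd e)) E"

definition colours :: "edges \<Rightarrow> nat list" where
  "colours E = map (\<lambda>e. snd (snd e)) E"

definition relabel :: "edges \<Rightarrow> edges" where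
  "relabel E = map (\<lambda>e. (rank (endpoints E) (fst e), rank (endpoints E) (fst (snd e)),
     rank (colours E) (snd (snd e)))) E"

text \<open>The square root rounded up is the number of \<open>i\<close> with
  \<open>i * i < k\<close>; such \<open>i\<close> lie below \<open>k\<close>, so a filter over a
  finite range finds them.\<close>

definition ceil_sqrt :: "nat \<Rightarrow> nat" where
  "ceil_sqrt k = length (filter (\<lambda>i. i * i < k) [0..<k])"

definition edge_bound :: "nat \<Rightarrow> nat \<Rightarrow> nat" where
  "edge_bound k r = 2 * k * (r + 2 * (r * r) + (2 * k + 1) * r) + r * ((2 * k + 1) * k)"

text \<open>The fallback, the empty graph with target 0, is a yes-instance of size 0.\<close>

definition finish :: "nat \<times> nat \<times> edges \<times> nat \<Rightarrow> nat \<times> nat \<times> edges \<times> nat" where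
  "finish p = (let n = fst p; q = fst (snd p); E = fst (snd (snd p)); k = snd (snd (snd p)) in
     if length E \<le> edge_bound k (ceil_sqrt k)
     then (rank (endpoints E) n, rank (colours E) q, relabel E, k) else (0, 0, [], 0))"

definition kernel :: "nat \<times> nat \<times> edges \<times> nat \<Rightarrow> nat \<times> nat \<times> edges \<times> nat" where
  "kernel p = finish (fst p, fst (snd p),
     prune_all (fst p) (fst (snd p)) (snd (snd (snd p))) (fst (snd (snd p))), snd (snd (snd p)))"

section \<open>Running time of the kernelization\<close>

lemma ptime_coloured_at:
  assumes "ptime eA enc_nat v" "ptime eA enc_nat c"
    and "ptime eA (enc_pair enc_nat (enc_pair enc_nat enc_nat)) e"
  shows "ptime eA enc_bool (\<lambda>x. coloured_at (v x) (c x) (e x))"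
proof (rule ptime_comp3[where h = coloured_at, OF _ assms])
  show "ptime (enc_pair enc_nat (enc_pair enc_nat (enc_pair enc_nat (enc_pair enc_nat enc_nat))))
     enc_bool (\<lambda>p. coloured_at (fst p) (fst (snd p)) (snd (snd p)))"
    unfolding coloured_at_def by (rule ptime_intros)+
qed

lemma ptime_colour_degree:
  assumes "ptime eA enc_edges E" "ptime eA enc_nat v" "ptime eA enc_nat c"
  shows "ptime eA enc_nat (\<lambda>x. colour_degree (E x) (v x) (c x))"
proof (rule ptime_comp3[where h = colour_degree, OF _ assms])
  show "ptime (enc_pair enc_edges (enc_pair enc_nat enc_nat)) enc_nat
     (\<lambda>p. colour_degree (fst p) (fst (snd p)) (snd (snd p)))"
    unfolding colour_degree_def by (rule ptime_intros ptime_coloured_at)+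
qed

lemma ptime_prune:
  "ptime (enc_pair (enc_pair enc_nat enc_nat) (enc_pair enc_nat (enc_pair enc_nat enc_edges)))
     enc_edges
     (\<lambda>p. prune (fst (fst p)) (snd (fst p)) (fst (snd p)) (fst (snd (snd p))) (snd (snd (snd p))))"
  unfolding prune_def rivals_def by (rule ptime_intros ptime_coloured_at ptime_colour_degree)+

text \<open>Supplies growth 0 for the two nested folds.\<close>

lemma dsize_prune: "dsize (enc_edges (prune q k v c E)) \<le> dsize (enc_edges E)"
proof -
  have "dsize (enc_edges (filter P E)) \<le> dsize (enc_edges E)" for P
    by (induction E) auto
  then show ?thesis unfolding prune_def by simp
qed

lemma dsize_fold_le:
  assumes "\<And>b a. dsize (e (step b a)) \<le> dsize (e a)"
  shows "dsize (e (fold step xs a)) \<le> dsize (e a)"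
proof (induction xs arbitrary: a)
  case (Cons x xs)
  show ?case using order_trans[OF Cons.IH assms] by simp
qed simp

lemma ptime_prune_vertex:
  "ptime (enc_pair (enc_pair enc_nat enc_nat) (enc_pair enc_nat enc_edges)) enc_edges
     (\<lambda>p. prune_vertex (fst (fst p)) (snd (fst p)) (fst (snd p)) (snd (snd p)))"
  unfolding prune_vertex_def
proof (rule ptime_fold_add[where eB = enc_nat and q = 0
      and step = "\<lambda>p. prune (fst (fst p)) (snd (fst p)) (fst (snd p))"])
  let ?A = "enc_pair (enc_pair enc_nat enc_nat) (enc_pair enc_nat enc_edges)"
  have "ptime (enc_pair ?A (enc_pair enc_nat enc_edges))
      (enc_pair (enc_pair enc_nat enc_nat) (enc_pair enc_nat (enc_pair enc_nat enc_edges)))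
      (\<lambda>z. (fst (fst z), fst (snd (fst z)), snd z))"
    by (rule ptime_intros)+
  from ptime_comp[OF this ptime_prune]
  show "ptime (enc_pair ?A (enc_pair enc_nat enc_edges)) enc_edges
     (\<lambda>z. prune (fst (fst (fst z))) (snd (fst (fst z))) (fst (snd (fst z))) (fst (snd z)) (snd (snd z)))"
    by simp
qed (auto intro!: ptime_intros dsize_prune)

lemma ptime_prune_all:
  "ptime (enc_pair enc_nat (enc_pair enc_nat (enc_pair enc_edges enc_nat))) enc_edges
     (\<lambda>p. prune_all (fst p) (fst (snd p)) (snd (snd (snd p))) (fst (snd (snd p))))"
  unfolding prune_all_def
proof (rule ptime_fold_add[where eB = enc_nat and q = 0
      and step = "\<lambda>p. prune_vertex (fst (snd p)) (snd (snd (snd p)))"])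
  let ?A = "enc_pair enc_nat (enc_pair enc_nat (enc_pair enc_edges enc_nat))"
  have "ptime (enc_pair ?A (enc_pair enc_nat enc_edges))
      (enc_pair (enc_pair enc_nat enc_nat) (enc_pair enc_nat enc_edges))
      (\<lambda>z. ((fst (snd (fst z)), snd (snd (snd (fst z)))), snd z))"
    by (rule ptime_intros)+
  from ptime_comp[OF this ptime_prune_vertex]
  show "ptime (enc_pair ?A (enc_pair enc_nat enc_edges)) enc_edges
     (\<lambda>z. prune_vertex (fst (snd (fst z))) (snd (snd (snd (fst z)))) (fst (snd z)) (snd (snd z)))"
    by simp
qed (auto intro!: ptime_intros dsize_fold_le dsize_prune simp: prune_vertex_def)

lemma ptime_rank:
  assumes "ptime eA (enc_list enc_nat) xs" "ptime eA enc_nat v"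
  shows "ptime eA enc_nat (\<lambda>x. rank (xs x) (v x))"
proof (rule ptime_comp2[where h = rank, OF _ assms])
  show "ptime (enc_pair (enc_list enc_nat) enc_nat) enc_nat (\<lambda>p. rank (fst p) (snd p))"
    unfolding rank_def by (rule ptime_intros)+
qed

lemma ptime_endpoints:
  assumes "ptime eA enc_edges E"
  shows "ptime eA (enc_list enc_nat) (\<lambda>x. endpoints (E x))"
proof (rule ptime_comp[where g = endpoints, OF assms])
  show "ptime enc_edges (enc_list enc_nat) endpoints"
    unfolding endpoints_def[abs_def] by (rule ptime_intros)+
qed

lemma ptime_colours:
  assumes "ptime eA enc_edges E"
  shows "ptime eA (enc_list enc_nat) (\<lambda>x. colours (E x))"
proof (rule ptime_comp[where g = colours, OF assms])
  show "ptime enc_edges (enc_list enc_nat) colours"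
    unfolding colours_def[abs_def] by (rule ptime_intros)+
qed

lemma ptime_finish:
  "ptime (enc_pair enc_nat (enc_pair enc_nat (enc_pair enc_edges enc_nat)))
     (enc_pair enc_nat (enc_pair enc_nat (enc_pair enc_edges enc_nat))) finish"
  unfolding finish_def[abs_def] Let_def relabel_def edge_bound_def ceil_sqrt_def
  by (rule ptime_intros ptime_rank ptime_endpoints ptime_colours)+

lemma ptime_kernel:
  "ptime (enc_pair enc_nat (enc_pair enc_nat (enc_pair enc_edges enc_nat)))
     (enc_pair enc_nat (enc_pair enc_nat (enc_pair enc_edges enc_nat))) kernel"
  unfolding kernel_def[abs_def]
  by (rule ptime_comp[OF _ ptime_finish] ptime_intros ptime_prune_all)+

section \<open>Correctness of the pruning step\<close>

definition ends :: "nat \<times> nat \<times> nat \<Rightarrow> nat set" where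
  "ends e = {fst e, fst (snd e)}"

definition edge_sets :: "edges \<Rightarrow> nat set set" where
  "edge_sets E = ends ` set E"

text \<open>The colouring is a separate parameter, so that of the original instance can stay fixed
  while the list shrinks.\<close>

definition proper :: "(nat set \<Rightarrow> nat) \<Rightarrow> edges \<Rightarrow> bool" where
  "proper l E \<longleftrightarrow> distinct (map ends E) \<and>
     (\<forall>e\<in>set E. fst e \<noteq> fst (snd e) \<and> l (ends e) = snd (snd e))"

lemma proper_simple_graph: "proper l E \<Longrightarrow> simple_graph (\<Union>(edge_sets E)) (edge_sets E)"
  unfolding proper_def simple_graph_def edge_sets_def ends_def by auto

lemma proper_filter: "proper l E \<Longrightarrow> proper l (filter P E)"
  unfolding proper_def by (auto simp: distinct_map_filter)

lemma proper_card: "proper l E \<Longrightarrow> card (edge_sets E) = length E"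
  unfolding proper_def edge_sets_def set_map[symmetric] by (simp add: distinct_card del: set_map)

lemma proper_coloured_edges_at:
  assumes "proper l E"
  shows "coloured_edges_at l (edge_sets E) v c = edge_sets (filter (coloured_at v c) E)"
  using assms unfolding coloured_edges_at_def edge_sets_def coloured_at_def proper_def ends_def
  by fastforce

lemma colour_degree_eq_card:
  assumes "proper l E"
  shows "colour_degree E v c = card (coloured_edges_at l (edge_sets E) v c)"
  unfolding proper_coloured_edges_at[OF assms] colour_degree_def
  using proper_card[OF proper_filter[OF assms]] by simp

text \<open>No two entries have the same ends, so an edge that is filtered out has no second entry
  to keep it alive.\<close>

lemma proper_filter_not:
  assumes "proper l E"
  shows "edge_sets (filter (\<lambda>e. \<not> P e) E) = edge_sets E - edge_sets (filter P E)"
proof -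
  have "inj_on ends (set E)" using assms unfolding proper_def by (simp add: distinct_map)
  then show ?thesis unfolding edge_sets_def by (auto dest: inj_onD)
qed

lemma length_filter_upt: "length (filter P [0..<n]) = card {i. i < n \<and> P i}"
  by (subst distinct_card[symmetric]) (auto intro: arg_cong[of _ _ card])

lemma rivals_eq_card:
  "rivals q E v c = card {d. d < q \<and> d \<noteq> c \<and> colour_degree E v c \<le> colour_degree E v d}"
  unfolding rivals_def length_filter_upt ..

lemma set_prune: "set (prune q k v c E) \<subseteq> set E"
  unfolding prune_def by auto

text \<open>Deleting edges cannot create solutions; the converse is the exchange of stars.\<close>

lemma prune_sound:
  assumes "proper l E"
  shows "proper l (prune q k v c E) \<and>
     (colored_clustering (edge_sets (prune q k v c E)) l k \<longleftrightarrow> colored_clustering (edge_sets E) l k)"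
proof (cases "rivals q E v c \<le> 2 * k")
  case True
  then show ?thesis using assms unfolding prune_def by simp
next
  case False
  define D where "D = {d. d < q \<and> d \<noteq> c \<and> colour_degree E v c \<le> colour_degree E v d}"
  have eq: "edge_sets (prune q k v c E) = edge_sets E - coloured_edges_at l (edge_sets E) v c"
    using False proper_filter_not[OF assms] proper_coloured_edges_at[OF assms] unfolding prune_def by simp
  have "colored_clustering (edge_sets E - coloured_edges_at l (edge_sets E) v c) l k"
    if "colored_clustering (edge_sets E) l k"
  proof (rule colored_clustering_remove_colour[OF proper_simple_graph[OF assms] _ _ _ _ that])
    show "2 * k < card D" using False unfolding D_def rivals_eq_card by simp
  qed (auto simp: D_def colour_degree_eq_card[OF assms])
  then show ?thesis
    using eq colored_clustering_mono[of _ l k "edge_sets E"] proper_filter[OF assms] False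
    unfolding prune_def by auto
qed

lemma fold_prune_sound:
  assumes "proper l E"
  shows "proper l (fold (prune q k v) cs E) \<and> set (fold (prune q k v) cs E) \<subseteq> set E \<and>
     (colored_clustering (edge_sets (fold (prune q k v) cs E)) l k \<longleftrightarrow>
      colored_clustering (edge_sets E) l k)"
  using assms
proof (induction cs arbitrary: E)
  case (Cons c cs)
  show ?case
    using Cons.IH[of "prune q k v c E"] prune_sound[OF Cons.prems, of q k v c] set_prune[of q k v c E]
    by auto
qed simp

text \<open>Pruning at \<open>v\<close> is all or nothing: the pruned colour vanishes there, and the
  edges of every other colour stay.\<close>

lemma colour_degree_prune:
  "colour_degree (prune q k v c E) v d = 0 \<or> colour_degree (prune q k v c E) v d = colour_degree E v d"
proof (cases "c = d")
  case True
  then show ?thesis unfolding prune_def colour_degree_def by (simp add: filter_empty_conv)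
next
  case False
  have "filter (coloured_at v d) (filter (\<lambda>e. \<not> coloured_at v c e) E) = filter (coloured_at v d) E"
    unfolding filter_filter using False by (intro filter_cong) (auto simp: coloured_at_def)
  then show ?thesis unfolding prune_def colour_degree_def by simp
qed

lemma colour_degree_fold_prune:
  "colour_degree (fold (prune q k v) cs E) v d = 0 \<or>
   colour_degree (fold (prune q k v) cs E) v d = colour_degree E v d"
proof (induction cs arbitrary: E)
  case (Cons c cs)
  show ?case using Cons.IH[of "prune q k v c E"] colour_degree_prune[of q k v c E d] by auto
qed simp

text \<open>If \<open>c\<close> survives, its degree at \<open>v\<close> is unchanged; a rival has
  at least this positive degree, so it is unchanged as well and was a rival before.\<close>

lemma rivals_mono:
  assumes "\<And>d. colour_degree E' v d = 0 \<or> colour_degree E' v d = colour_degree E v d"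
    and "colour_degree E' v c \<noteq> 0"
  shows "rivals q E' v c \<le> rivals q E v c"
  unfolding rivals_eq_card
proof (rule card_mono)
  show "{d. d < q \<and> d \<noteq> c \<and> colour_degree E' v c \<le> colour_degree E' v d}
      \<subseteq> {d. d < q \<and> d \<noteq> c \<and> colour_degree E v c \<le> colour_degree E v d}"
    using assms(2) by (smt (verit, ccfv_threshold) assms(1) le_zero_eq mem_Collect_eq subsetI)
qed simp

text \<open>One pass suffices: a surviving colour had few rivals at its last turn, and later
  prunings at \<open>v\<close> add none.\<close>

lemma rivals_fold_prune:
  assumes "c \<in> set cs" "colour_degree (fold (prune q k v) cs E) v c \<noteq> 0"
  shows "rivals q (fold (prune q k v) cs E) v c \<le> 2 * k"
  using assms
proof (induction cs arbitrary: E)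
  case (Cons d cs)
  show ?case
  proof (cases "c \<in> set cs")
    case True
    then show ?thesis using Cons by simp
  next
    case False
    let ?E = "prune q k v c E"
    \<comment> \<open>As \<open>c\<close> does not recur in \<open>cs\<close>, this is its last
      turn; having edges at \<open>v\<close> in the end, it was not pruned now.\<close>
    have d: "d = c" using False Cons.prems by simp
    have "colour_degree ?E v c \<noteq> 0"
      using Cons.prems(2) colour_degree_fold_prune[of q k v cs ?E c] d by auto
    then have "rivals q E v c \<le> 2 * k"
      unfolding prune_def colour_degree_def by (auto simp: filter_empty_conv split: if_splits)
    moreover from this have "?E = E" unfolding prune_def by simp
    ultimately show ?thesis
      using rivals_mono[of "fold (prune q k v) cs E" v E c q] colour_degree_fold_prune[of q k v cs E]
        Cons.prems(2) d by fastforce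
  qed
qed simp

text \<open>All other colours left at \<open>v\<close> are rivals of the least frequent one, which
  survived and so has at most \<open>2 * k\<close>; the additional 1 counts that colour
  itself.\<close>

lemma card_colours_prune_vertex:
  assumes pr: "proper l E" and q: "\<And>e. e \<in> set E \<Longrightarrow> snd (snd e) < q"
  shows "card (l ` edges_at (edge_sets (prune_vertex q k v E)) v) \<le> 2 * k + 1"
proof (rule ccontr)
  let ?E = "prune_vertex q k v E"
  assume many: "\<not> ?thesis"
  have E: "proper l ?E" "set ?E \<subseteq> set E" using fold_prune_sound[OF pr] unfolding prune_vertex_def by auto
  define P where "P = l ` edges_at (edge_sets ?E) v"
  have P: "d < q \<and> colour_degree ?E v d \<noteq> 0" if dP: "d \<in> P" for d
  proof -
    obtain e where e: "e \<in> set ?E" "v \<in> ends e" "d = l (ends e)"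
      using dP unfolding P_def edges_at_def edge_sets_def by blast
    then have "d = snd (snd e)" using E(1) unfolding proper_def by auto
    moreover have "snd (snd e) < q" using q E(2) e(1) by blast
    ultimately show ?thesis
      using e unfolding colour_degree_def coloured_at_def ends_def
      by (auto simp: filter_empty_conv)
  qed
  have finP: "finite P" by (rule finite_subset[of _ "{..<q}"]) (use P in auto)
  have "P \<noteq> {}" using many unfolding P_def by force
  then obtain c where c: "c \<in> P" "\<And>d. d \<in> P \<Longrightarrow> colour_degree ?E v c \<le> colour_degree ?E v d"
    using ex_min_if_finite[of "colour_degree ?E v ` P"] finP
    by (metis (no_types, lifting) arg_min_if_finite(1) arg_min_least)
  have "card (P - {c}) \<le> rivals q ?E v c"
    unfolding rivals_eq_card using P c by (intro card_mono) auto
  also have "\<dots> \<le> 2 * k"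
    unfolding prune_vertex_def
    by (rule rivals_fold_prune) (use P[OF c(1)] in \<open>auto simp: prune_vertex_def\<close>)
  finally show False using many c(1) finP unfolding P_def[symmetric] by simp
qed

lemma card_image_edges_at_mono:
  assumes "set E' \<subseteq> set E"
  shows "card (l ` edges_at (edge_sets E') v) \<le> card (l ` edges_at (edge_sets E) v)"
  using assms by (intro card_mono image_mono) (auto simp: edges_at_def edge_sets_def)

text \<open>Induction from the right: the vertex treated last gets its bound from its own pass, and
  for earlier ones further deletions only shrink the palette.\<close>

lemma fold_prune_vertex_sound:
  fixes k :: nat
  assumes "proper l E" "\<And>e. e \<in> set E \<Longrightarrow> snd (snd e) < q"
  defines "E' vs \<equiv> fold (prune_vertex q k) vs E"
  shows "proper l (E' vs) \<and> set (E' vs) \<subseteq> set E \<and>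
     (colored_clustering (edge_sets (E' vs)) l k \<longleftrightarrow> colored_clustering (edge_sets E) l k) \<and>
     (\<forall>v\<in>set vs. card (l ` edges_at (edge_sets (E' vs)) v) \<le> 2 * k + 1)"
proof (induction vs rule: rev_induct)
  case Nil
  then show ?case using assms by simp
next
  case (snoc v vs)
  have step: "E' (vs @ [v]) = prune_vertex q k v (E' vs)" unfolding E'_def by simp
  note sound = fold_prune_sound[of l "E' vs" q k v "[0..<q]", folded prune_vertex_def]
  have "card (l ` edges_at (edge_sets (E' (vs @ [v]))) v) \<le> 2 * k + 1"
    unfolding step by (rule card_colours_prune_vertex) (use snoc assms(2) in auto)
  moreover have "card (l ` edges_at (edge_sets (E' (vs @ [v]))) u) \<le> 2 * k + 1" if "u \<in> set vs" for u
    unfolding step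
    using card_image_edges_at_mono[of "prune_vertex q k v (E' vs)" "E' vs" l u] sound snoc that by fastforce
  ultimately show ?case unfolding step using sound snoc by auto
qed

section \<open>Relabelling\<close>

lemma rank_eq_card: "rank xs v = card {u. u < v \<and> u \<in> set xs}"
  unfolding rank_def length_filter_upt ..

lemma rank_strict_mono: "u \<in> set xs \<Longrightarrow> u < v \<Longrightarrow> rank xs u < rank xs v"
  unfolding rank_eq_card by (rule psubset_card_mono) auto

lemma inj_on_rank: "inj_on (rank xs) (set xs)"
  by (rule linorder_inj_onI') (metis rank_strict_mono less_irrefl)

lemma rank_le_length: "rank xs v \<le> length xs"
proof -
  have "rank xs v \<le> card (set xs)" unfolding rank_eq_card by (intro card_mono) auto
  then show ?thesis using card_length[of xs] by linarith
qed

lemma edges_of_eq: "edges_of I = edge_sets (edge_list I)"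
  unfolding edges_of_def edge_sets_def ends_def by (simp add: case_prod_unfold)

lemma cc_wf_iff:
  "cc_wf I \<longleftrightarrow> distinct (map ends (edge_list I)) \<and>
     (\<forall>e\<in>set (edge_list I). fst e < nverts I \<and> fst (snd e) < nverts I \<and> fst e \<noteq> fst (snd e) \<and>
        snd (snd e) < ncolors I)"
proof -
  have "(\<lambda>(u, v, c). {u, v}) = ends" by (auto simp: ends_def)
  then show ?thesis unfolding cc_wf_def by auto
qed

lemma cc_wf_color_of_ends: "cc_wf I \<Longrightarrow> e \<in> set (edge_list I) \<Longrightarrow> color_of I (ends e) = snd (snd e)"
  unfolding ends_def by (rule cc_wf_color_of) auto

lemma cc_wf_proper: "cc_wf I \<Longrightarrow> proper (color_of I) (edge_list I)"
  unfolding proper_def using cc_wf_color_of_ends[of I] by (auto simp: cc_wf_iff)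

lemma Union_edge_sets: "\<Union>(edge_sets E) = set (endpoints E)"
  unfolding edge_sets_def ends_def endpoints_def by auto

text \<open>\<open>rank\<close> is injective on the names that occur and increases strictly from
  each of them to the bounds \<open>n\<close> and \<open>q\<close>, so new names are distinct and
  lie below the new counts.\<close>

lemma relabel_sound:
  fixes n q k :: nat
  assumes pr: "proper l E"
    and E: "\<And>e. e \<in> set E \<Longrightarrow> fst e < n \<and> fst (snd e) < n \<and> snd (snd e) < q"
  defines "J \<equiv> \<lparr>nverts = rank (endpoints E) n, ncolors = rank (colours E) q,
       edge_list = relabel E, target = k\<rparr>"
  shows "cc_wf J"
    and "colored_clustering (edges_of J) (color_of J) k \<longleftrightarrow> colored_clustering (edge_sets E) l k"
proof -
  let ?f = "rank (endpoints E)" and ?g = "rank (colours E)"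
  let ?\<phi> = "\<lambda>e. (?f (fst e), ?f (fst (snd e)), ?g (snd (snd e)))"
  have f: "inj_on ?f (\<Union>(edge_sets E))" unfolding Union_edge_sets by (rule inj_on_rank)
  have ends_rel: "ends (?\<phi> e) = ?f ` ends e" for e by (simp add: ends_def)
  have mem: "fst e \<in> set (endpoints E)" "fst (snd e) \<in> set (endpoints E)"
    "snd (snd e) \<in> set (colours E)" if "e \<in> set E" for e
    using that unfolding endpoints_def colours_def by auto
  have rel: "map ends (relabel E) = map ((`) ?f) (map ends E)"
    unfolding relabel_def by (simp add: ends_rel)
  have "inj_on ((`) ?f) (set (map ends E))"
    using inj_on_image[OF f] unfolding edge_sets_def by simp
  then have dist: "distinct (map ends (relabel E))"
    using pr unfolding rel proper_def by (simp add: distinct_map del: map_map set_map)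
  show wf: "cc_wf J"
    unfolding cc_wf_iff
  proof (intro conjI ballI)
    show "distinct (map ends (edge_list J))" using dist unfolding J_def by simp
    fix e' assume "e' \<in> set (edge_list J)"
    then obtain e where e: "e \<in> set E" "e' = ?\<phi> e" unfolding J_def relabel_def by auto
    note m = mem[OF e(1)] and b = E[OF e(1)]
    show "fst e' < nverts J" "fst (snd e') < nverts J" "snd (snd e') < ncolors J"
      using e m b unfolding J_def by (auto intro: rank_strict_mono)
    show "fst e' \<noteq> fst (snd e')"
      using e m pr inj_onD[OF inj_on_rank, of "endpoints E" "fst e" "fst (snd e)"]
      unfolding proper_def by auto
  qed
  have col: "color_of J (?f ` X) = ?g (l X)" if X: "X \<in> edge_sets E" for X
  proof -
    obtain e where e: "e \<in> set E" "X = ends e" using X unfolding edge_sets_def by blast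
    have "?\<phi> e \<in> set (edge_list J)" using e unfolding J_def relabel_def by auto
    from cc_wf_color_of_ends[OF wf this] show ?thesis
      using e pr unfolding ends_rel proper_def by simp
  qed
  have "l ` edge_sets E = set (colours E)"
    using pr unfolding edge_sets_def colours_def proper_def by (auto simp: image_image)
  then have g: "inj_on ?g (l ` edge_sets E)" using inj_on_rank by simp
  have "edges_of J = (`) ?f ` edge_sets E"
    unfolding edges_of_eq edge_sets_def J_def
    using rel by (simp add: set_map[symmetric] del: set_map)
  then show "colored_clustering (edges_of J) (color_of J) k \<longleftrightarrow> colored_clustering (edge_sets E) l k"
    using colored_clustering_image[OF f g col] by simp
qed

section \<open>The kernel\<close>

lemma ceil_sqrt_eq_card: "ceil_sqrt k = card {i. i < k \<and> i * i < k}"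
  unfolding ceil_sqrt_def length_filter_upt ..

text \<open>Otherwise all \<open>?r + 1\<close> numbers up to \<open>?r\<close> would be among the
  \<open>?r\<close> numbers counted.\<close>

lemma le_ceil_sqrt_square: "k \<le> ceil_sqrt k * ceil_sqrt k"
proof (rule ccontr)
  let ?r = "ceil_sqrt k"
  assume "\<not> ?thesis"
  then have r: "?r * ?r < k" by simp
  have "i < k \<and> i * i < k" if "i \<le> ?r" for i
  proof -
    have "i * i < k" using mult_le_mono[OF that that] r by linarith
    moreover have "i \<le> i * i" by (cases i) auto
    ultimately show ?thesis by linarith
  qed
  then have "card {..?r} \<le> card {i. i < k \<and> i * i < k}" by (intro card_mono) auto
  then show False unfolding ceil_sqrt_eq_card[symmetric] by simp
qed

lemma ceil_sqrt_le: "real (ceil_sqrt k) \<le> sqrt (real k) + 1"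
proof -
  have "{i. i < k \<and> i * i < k} \<subseteq> {..<nat \<lceil>sqrt (real k)\<rceil>}"
  proof
    fix i assume "i \<in> {i. i < k \<and> i * i < k}"
    then have "real i * real i < real k" by (metis mem_Collect_eq of_nat_less_iff of_nat_mult)
    then have "real i < sqrt (real k)" by (intro real_less_rsqrt) (simp add: power2_eq_square)
    then show "i \<in> {..<nat \<lceil>sqrt (real k)\<rceil>}" by (simp add: less_ceiling_iff zless_nat_eq_int_zless)
  qed
  then have "ceil_sqrt k \<le> nat \<lceil>sqrt (real k)\<rceil>"
    unfolding ceil_sqrt_eq_card by (metis card_mono card_lessThan finite_lessThan)
  then have "real (ceil_sqrt k) \<le> real (nat \<lceil>sqrt (real k)\<rceil>)" by (rule of_nat_mono)
  also have "\<dots> = real_of_int \<lceil>sqrt (real k)\<rceil>" by simp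
  finally show ?thesis using of_int_ceiling_le_add_one[of "sqrt (real k)"] by linarith
qed

text \<open>Each edge accounts for at most two vertices, one colour and one list entry; the target
  adds \<open>k\<close>.\<close>

definition kernel_size :: "nat \<Rightarrow> nat" where
  "kernel_size k = 4 * edge_bound k (ceil_sqrt k) + k"

lemma kernel_size_bigo: "(\<lambda>k. real (kernel_size k)) \<in> O(\<lambda>k. real k powr (5/2))"
\<comment> \<open>\<open>153 = 4 * (32 + 6) + 1\<close>: light vertices, heavy vertices and the
  target, each measured in \<open>t ^ 5\<close> below.\<close>
proof (rule bigoI[where c = 153])
  have "real (kernel_size k) \<le> 153 * real k powr (5/2)" if "1 \<le> k" for k
  proof -
    define t where "t = sqrt (real k)"
    define r where "r = real (ceil_sqrt k)"
    have t: "1 \<le> t" "real k = t ^ 2" unfolding t_def using that by auto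
    have r: "0 \<le> r" "r \<le> 2 * t" using ceil_sqrt_le[of k] t(1) unfolding r_def t_def by linarith+
    have p: "t \<le> t ^ 3" "t ^ 2 \<le> t ^ 3" "t ^ 2 \<le> t ^ 5" "t ^ 3 \<le> t ^ 5"
      using t power_increasing[of _ _ t] power_increasing[of 1 3 t] by auto
    have "r * r \<le> 4 * t ^ 2"
      using mult_mono[OF r(2) r(2)] r t by (simp add: power2_eq_square)
    moreover have rk: "(2 * t ^ 2 + 1) * r \<le> (2 * t ^ 2 + 1) * (2 * t)"
      using r by (intro mult_left_mono) auto
    moreover have "(2 * t ^ 2 + 1) * (2 * t) = 4 * t ^ 3 + 2 * t"
      by (simp add: algebra_simps power3_eq_cube power2_eq_square)
    \<comment> \<open>The summands are at most \<open>2 * t\<close>, \<open>8 * t ^ 2\<close> and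
      \<open>4 * t ^ 3 + 2 * t\<close>; all powers are absorbed into \<open>t ^ 3\<close> since
      \<open>1 \<le> t\<close>.\<close>
    ultimately have "r + 2 * (r * r) + (2 * t ^ 2 + 1) * r \<le> 16 * t ^ 3"
      using p r(2) by linarith
    then have "2 * t ^ 2 * (r + 2 * (r * r) + (2 * t ^ 2 + 1) * r) \<le> 2 * t ^ 2 * (16 * t ^ 3)"
      by (intro mult_left_mono) auto
    also have "\<dots> = 32 * t ^ 5" by (simp flip: power_add)
    finally have 1: "2 * t ^ 2 * (r + 2 * (r * r) + (2 * t ^ 2 + 1) * r) \<le> 32 * t ^ 5" .
    have 2: "r * ((2 * t ^ 2 + 1) * t ^ 2) \<le> 6 * t ^ 5"
    proof -
      have "r * ((2 * t ^ 2 + 1) * t ^ 2) \<le> (2 * t) * ((2 * t ^ 2 + 1) * t ^ 2)"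
        using r by (intro mult_right_mono) auto
      also have "\<dots> = 4 * t ^ 5 + 2 * t ^ 3" by (simp add: algebra_simps eval_nat_numeral)
      finally show ?thesis using p by linarith
    qed
    have "real (kernel_size k) =
       4 * (2 * t ^ 2 * (r + 2 * (r * r) + (2 * t ^ 2 + 1) * r) + r * ((2 * t ^ 2 + 1) * t ^ 2)) + t ^ 2"
      unfolding kernel_size_def edge_bound_def r_def t(2)[symmetric] by (simp add: algebra_simps)
    also have "\<dots> \<le> 4 * (32 * t ^ 5 + 6 * t ^ 5) + t ^ 5"
      by (intro add_mono mult_left_mono 1 2 p(3)) simp
    finally have "real (kernel_size k) \<le> 153 * t ^ 5" by simp
    moreover have "t ^ 5 = real k powr (5/2)"
      using that unfolding t_def by (simp add: powr_half_sqrt[symmetric] powr_power)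
    ultimately show ?thesis by simp
  qed
  then show "\<forall>\<^sub>F k in at_top. norm (real (kernel_size k)) \<le> 153 * norm (real k powr (5/2))"
    by (auto simp: eventually_at_top_linorder)
qed

section \<open>From tuples to instances\<close>

definition to_tuple :: "cc_instance \<Rightarrow> nat \<times> nat \<times> edges \<times> nat" where
  "to_tuple I = (nverts I, ncolors I, edge_list I, target I)"

definition of_tuple :: "nat \<times> nat \<times> edges \<times> nat \<Rightarrow> cc_instance" where
  "of_tuple p = \<lparr>nverts = fst p, ncolors = fst (snd p), edge_list = fst (snd (snd p)),
     target = snd (snd (snd p))\<rparr>"

lemma to_tuple_of_tuple: "to_tuple (of_tuple p) = p"
  unfolding to_tuple_def of_tuple_def by simp

lemma enc_cc_eq:
  "enc_cc I = enc_pair enc_nat (enc_pair enc_nat (enc_pair enc_edges enc_nat)) (to_tuple I)"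
proof -
  have "enc_edge = enc_pair enc_nat (enc_pair enc_nat enc_nat)" by (auto simp: fun_eq_iff)
  then show ?thesis unfolding enc_cc_def to_tuple_def by simp
qed

definition kernelize :: "cc_instance \<Rightarrow> cc_instance" where
  "kernelize I = of_tuple (kernel (to_tuple I))"

lemma polytime_kernelize: "polytime_on S enc_cc enc_cc kernelize"
proof -
  have "ptime enc_cc enc_cc kernelize"
    using ptime_kernel unfolding ptime_def computes_def enc_cc_eq kernelize_def to_tuple_of_tuple
    by blast
  then show ?thesis by (rule ptime_polytime_on)
qed

lemma kernelize_sound:
  assumes wf: "cc_wf I"
  shows "cc_wf (kernelize I)"
    and "colored_clustering (edges_of (kernelize I)) (color_of (kernelize I)) (target (kernelize I)) \<longleftrightarrow>
       colored_clustering (edges_of I) (color_of I) (target I)"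
    and "cc_size (kernelize I) \<le> kernel_size (target I)"
proof -
  define k where "k = target I"
  define l where "l = color_of I"
  define E where "E = prune_all (nverts I) (ncolors I) k (edge_list I)"
  let ?b = "edge_bound k (ceil_sqrt k)"
  have E: "proper l E" "set E \<subseteq> set (edge_list I)"
    "colored_clustering (edge_sets E) l k \<longleftrightarrow> colored_clustering (edge_sets (edge_list I)) l k"
    "\<And>v. v < nverts I \<Longrightarrow> card (l ` edges_at (edge_sets E) v) \<le> 2 * k + 1"
    using fold_prune_vertex_sound[OF cc_wf_proper[OF wf], of "ncolors I" k "[0..<nverts I]"] wf
    unfolding l_def E_def prune_all_def cc_wf_iff by auto
  have EI: "fst e < nverts I \<and> fst (snd e) < nverts I \<and> snd (snd e) < ncolors I" if "e \<in> set E" for e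
    using that E(2) wf unfolding cc_wf_iff by auto
  \<comment> \<open>The counting lemma asks for every \<open>v\<close>; a number outside the vertex
    set lies on no edge.\<close>
  have palette: "card (l ` edges_at (edge_sets E) v) \<le> 2 * k + 1" for v
  proof (cases "v < nverts I")
    case False
    then have "edges_at (edge_sets E) v = {}"
      using EI unfolding edges_at_def edge_sets_def ends_def by auto
    then show ?thesis by simp
  qed (rule E(4))
  have yes: "colored_clustering (edge_sets E) l k" if "?b < length E"
    by (rule colored_clustering_if_many_edges[OF proper_simple_graph[OF E(1)] palette
          le_ceil_sqrt_square]) (use that proper_card[OF E(1)] in \<open>simp add: edge_bound_def\<close>)
  define J where "J = \<lparr>nverts = rank (endpoints E) (nverts I), ncolors = rank (colours E) (ncolors I),
       edge_list = relabel E, target = k\<rparr>"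
  have K: "kernelize I = (if length E \<le> ?b then J
      else \<lparr>nverts = 0, ncolors = 0, edge_list = [], target = 0\<rparr>)"
    unfolding kernelize_def kernel_def finish_def of_tuple_def to_tuple_def J_def E_def k_def
    by (simp add: Let_def)
  have J: "cc_wf J" "colored_clustering (edges_of J) (color_of J) k \<longleftrightarrow> colored_clustering (edge_sets E) l k"
    using relabel_sound[OF E(1) EI, of k] unfolding J_def by auto
  show "cc_wf (kernelize I)" using J(1) unfolding K by (simp add: cc_wf_def)
  show "colored_clustering (edges_of (kernelize I)) (color_of (kernelize I)) (target (kernelize I)) \<longleftrightarrow>
       colored_clustering (edges_of I) (color_of I) (target I)"
  proof (cases "length E \<le> ?b")
    case True
    then have "kernelize I = J" "target J = k" unfolding K J_def by auto
    then show ?thesis using J(2) E(3) unfolding k_def l_def edges_of_eq by simp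
  next
    \<comment> \<open>With too many edges left the answer is yes, and the output is a yes-instance
      through the empty edge set.\<close>
    case False
    then have "target (kernelize I) = 0" unfolding K by simp
    moreover have "colored_clustering (edges_of I) (color_of I) (target I)"
      using yes False E(3) unfolding k_def l_def edges_of_eq by simp
    moreover have "colored_clustering F c 0" for F :: "nat set set" and c :: "nat set \<Rightarrow> nat"
      unfolding colored_clustering_def stable_def by auto
    ultimately show ?thesis by simp
  qed
  show "cc_size (kernelize I) \<le> kernel_size (target I)"
  proof (cases "length E \<le> ?b")
    case True
    have "nverts J \<le> 2 * length E" "ncolors J \<le> length E" "length (edge_list J) = length E"
      using rank_le_length[of "endpoints E" "nverts I"] rank_le_length[of "colours E" "ncolors I"]
      unfolding J_def by (auto simp: endpoints_def colours_def relabel_def)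
    then show ?thesis
      using True unfolding K kernel_size_def cc_size_def k_def by (simp add: J_def k_def)
  next
    case False
    then show ?thesis unfolding K cc_size_def by simp
  qed
qed

theorem theorem2: "admits_kernel_of_size Colored_Clustering (\<lambda>k. real k powr (5/2))"
  unfolding admits_kernel_of_size_def
proof (intro exI conjI)
  show "kernelization Colored_Clustering kernelize kernel_size"
    unfolding kernelization_def Colored_Clustering_def
    using polytime_kernelize kernelize_sound by simp
qed (rule kernel_size_bigo)

end
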